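(* Let $1\le p<\infty$ and let $d_{w,p}$ be a Lorentz sequence space with unit vector basis $(e_n)$. An operator $T\in L(d_{w,p})$ is $d_{w,p}$-strictly singular if and only if $\|Te_n\|\to 0$.
   Context: Let $1\le p<\infty$ and let $w=(w_n)$ be a real sequence with $w_1=1$, $w_n\downarrow 0$ and $\sum_n w_n=\infty$. The Lorentz sequence space $d_{w,p}$ is the Banach space of all $x=(x_n)\in c_0$ with $\|x\|_{d_{w,p}}=\big(\sum_{n}w_n (x^*_n)^p\big)^{1/p}<\infty$, where $(x^*_n)$ is the non-increasing rearrangement of $(|x_n|)$; $e_n$ is the sequence with $1$ in position $n$ and $0$ elsewhere. An operator $T\in L(d_{w,p})$ is $d_{w,p}$-strictly singular if for every closed subspace $Z\subseteq d_{w,p}$ isomorphic to $d_{w,p}$, the restriction $T|_Z$ is not an isomorphism. *)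

theory Defs
  imports "HOL-Analysis.Analysis"
begin

text \<open>Sequences are indexed from 0 (so the paper's w_1 is w 0, e_1 is unit 0).\<close>

text \<open>Non-increasing rearrangement of (|x_n|): x*_n is the (n+1)-th largest value,
  i.e. the infimum over sets F of at most n indices of sup_{k not in F} |x_k|.\<close>
definition xstar :: "(nat \<Rightarrow> real) \<Rightarrow> nat \<Rightarrow> real" where
  "xstar x n = Inf {Sup {\<bar>x k\<bar> | k. k \<notin> F} | F. finite F \<and> card F \<le> n}"

definition lorentz_norm :: "(nat \<Rightarrow> real) \<Rightarrow> real \<Rightarrow> (nat \<Rightarrow> real) \<Rightarrow> real" where
  "lorentz_norm w p x = (\<Sum>n. w n * (xstar x n) powr p) powr (1 / p)"

definition lorentz_space :: "(nat \<Rightarrow> real) \<Rightarrow> real \<Rightarrow> (nat \<Rightarrow> real) set" where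
  "lorentz_space w p = {x. x \<longlonglongrightarrow> 0 \<and> summable (\<lambda>n. w n * (xstar x n) powr p)}"

definition unit_vec :: "nat \<Rightarrow> nat \<Rightarrow> real" where
  "unit_vec n = (\<lambda>k. if k = n then 1 else 0)"

definition linear_on :: "(nat \<Rightarrow> real) set \<Rightarrow> ((nat \<Rightarrow> real) \<Rightarrow> (nat \<Rightarrow> real)) \<Rightarrow> bool" where
  "linear_on D T \<longleftrightarrow>
     (\<forall>x\<in>D. \<forall>y\<in>D. T (\<lambda>k. x k + y k) = (\<lambda>k. T x k + T y k)) \<and>
     (\<forall>x\<in>D. \<forall>a::real. T (\<lambda>k. a * x k) = (\<lambda>k. a * T x k))"

definition lorentz_operator :: "(nat \<Rightarrow> real) \<Rightarrow> real \<Rightarrow> ((nat \<Rightarrow> real) \<Rightarrow> (nat \<Rightarrow> real)) \<Rightarrow> bool" where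
  "lorentz_operator w p T \<longleftrightarrow>
     linear_on (lorentz_space w p) T \<and>
     (\<forall>x\<in>lorentz_space w p. T x \<in> lorentz_space w p) \<and>
     (\<exists>C. \<forall>x\<in>lorentz_space w p. lorentz_norm w p (T x) \<le> C * lorentz_norm w p x)"

definition lin_subspace :: "(nat \<Rightarrow> real) set \<Rightarrow> bool" where
  "lin_subspace Z \<longleftrightarrow> (\<lambda>k. 0) \<in> Z \<and>
     (\<forall>x\<in>Z. \<forall>y\<in>Z. (\<lambda>k. x k + y k) \<in> Z) \<and>
     (\<forall>x\<in>Z. \<forall>a::real. (\<lambda>k. a * x k) \<in> Z)"

definition closed_lorentz_subspace :: "(nat \<Rightarrow> real) \<Rightarrow> real \<Rightarrow> (nat \<Rightarrow> real) set \<Rightarrow> bool" where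
  "closed_lorentz_subspace w p Z \<longleftrightarrow> lin_subspace Z \<and> Z \<subseteq> lorentz_space w p \<and>
     (\<forall>f x. (\<forall>j. f j \<in> Z) \<and> x \<in> lorentz_space w p \<and>
        (\<lambda>j. lorentz_norm w p (\<lambda>k. f j k - x k)) \<longlonglongrightarrow> 0 \<longrightarrow> x \<in> Z)"

definition iso_to_lorentz :: "(nat \<Rightarrow> real) \<Rightarrow> real \<Rightarrow> (nat \<Rightarrow> real) set \<Rightarrow> bool" where
  "iso_to_lorentz w p Z \<longleftrightarrow>
     (\<exists>S c C. linear_on (lorentz_space w p) S \<and> S ` lorentz_space w p = Z \<and> 0 < c \<and>
        (\<forall>x\<in>lorentz_space w p.
           c * lorentz_norm w p x \<le> lorentz_norm w p (S x) \<and>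
           lorentz_norm w p (S x) \<le> C * lorentz_norm w p x))"

definition iso_on :: "(nat \<Rightarrow> real) \<Rightarrow> real \<Rightarrow> ((nat \<Rightarrow> real) \<Rightarrow> (nat \<Rightarrow> real)) \<Rightarrow> (nat \<Rightarrow> real) set \<Rightarrow> bool" where
  "iso_on w p T Z \<longleftrightarrow>
     (\<exists>c>0. \<forall>z\<in>Z. c * lorentz_norm w p z \<le> lorentz_norm w p (T z))"

definition lorentz_strictly_singular :: "(nat \<Rightarrow> real) \<Rightarrow> real \<Rightarrow> ((nat \<Rightarrow> real) \<Rightarrow> (nat \<Rightarrow> real)) \<Rightarrow> bool" where
  "lorentz_strictly_singular w p T \<longleftrightarrow>
     (\<forall>Z. closed_lorentz_subspace w p Z \<and> iso_to_lorentz w p Z \<longrightarrow> \<not> iso_on w p T Z)"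

end

theory Submission
  imports Defs
begin

text \<open>
  The key fact is that for a bounded operator \<open>S\<close> and \<open>\<delta> > 0\<close> there is \<open>\<epsilon> > 0\<close> such that, for all
  large \<open>n\<close>, the coordinates of modulus at most \<open>\<epsilon>\<close> contribute less than \<open>\<delta>\<close> to the norm of
  \<open>S e\<^sub>n\<close>; otherwise the space would carry lower \<open>\<ell>\<^sub>p\<close>-estimates on images of \<open>N\<close> unit
  vectors, contradicting \<open>(w\<^sub>1 + \<dots> + w\<^sub>N) / N \<rightarrow> 0\<close>.

  If \<open>T e\<^sub>n\<close> does not tend to \<open>0\<close>, then infinitely many \<open>T e\<^sub>n\<close> have a coordinate bounded away from
  \<open>0\<close>. A gliding hump argument makes \<open>T\<close> nearly diagonal, hence bounded below, on the span of a
  subsequence of the unit vectors, which is an isometric copy of the space.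

  If \<open>T e\<^sub>n \<rightarrow> 0\<close> and \<open>S\<close> is an isomorphic embedding, split \<open>S e\<^sub>n\<close> into its small coordinates, of
  small norm by the key fact, and its large ones. The latter are bounded in number and
  size and move to infinity, so \<open>T\<close> maps this part to a null sequence. Hence \<open>T\<close> is not bounded
  below on the range of \<open>S\<close>.
\<close>

section \<open>Non-increasing rearrangements\<close>

text \<open>Boundedness of \<open>x\<close> makes the real-valued \<open>Sup\<close> and
  \<open>Inf\<close> behave as intended: every inner supremum is at least 0, so the infimum runs
  over a set bounded below, and \<open>F\<close> is one of its competitors.\<close>

lemma xstar_le:
  assumes "finite F" "card F \<le> n" "\<And>k. k \<notin> F \<Longrightarrow> \<bar>x k\<bar> \<le> b" "Bseq x"
  shows "xstar x n \<le> b"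
proof -
  have ne: "\<exists>k. k \<notin> G" if "finite G" for G :: "nat set"
    using that ex_new_if_finite infinite_UNIV_nat by blast
  have S: "Sup {\<bar>x k\<bar> | k. k \<notin> F} \<le> b"
    by (rule cSup_least) (use assms ne in auto)
  obtain K where K: "\<And>k. \<bar>x k\<bar> \<le> K" using assms(4) by (auto simp: Bseq_def)
  have "bdd_below {Sup {\<bar>x k\<bar> | k. k \<notin> G} | G. finite G \<and> card G \<le> n}"
  proof (rule bdd_belowI)
    fix s assume "s \<in> {Sup {\<bar>x k\<bar> | k. k \<notin> G} | G. finite G \<and> card G \<le> n}"
    then obtain G where G: "finite G" "s = Sup {\<bar>x k\<bar> | k. k \<notin> G}" by auto
    obtain k where "k \<notin> G" using ne G by blast
    moreover have "bdd_above {\<bar>x k\<bar> | k. k \<notin> G}" by (rule bdd_aboveI[of _ K]) (use K in auto)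
    ultimately have "\<bar>x k\<bar> \<le> s" unfolding G(2) by (intro cSup_upper) auto
    then show "0 \<le> s" by linarith
  qed
  then show ?thesis unfolding xstar_def
    by (intro order_trans[OF cInf_lower S]) (use assms in auto)
qed

lemma xstar_ge:
  assumes "\<And>F. finite F \<Longrightarrow> card F \<le> n \<Longrightarrow> \<exists>k. k \<notin> F \<and> b \<le> \<bar>x k\<bar>" "Bseq x"
  shows "b \<le> xstar x n"
  unfolding xstar_def
proof (rule cInf_greatest)
  show "{Sup {\<bar>x k\<bar> | k. k \<notin> G} | G. finite G \<and> card G \<le> n} \<noteq> {}" by (auto intro!: exI[of _ "{}"])
next
  obtain K where K: "\<And>k. \<bar>x k\<bar> \<le> K" using assms(2) by (auto simp: Bseq_def)
  fix s assume "s \<in> {Sup {\<bar>x k\<bar> | k. k \<notin> G} | G. finite G \<and> card G \<le> n}"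
  then obtain G where G: "finite G" "card G \<le> n" "s = Sup {\<bar>x k\<bar> | k. k \<notin> G}" by auto
  obtain k where k: "k \<notin> G" "b \<le> \<bar>x k\<bar>" using assms G by blast
  have "bdd_above {\<bar>x k\<bar> | k. k \<notin> G}" by (rule bdd_aboveI[of _ K]) (use K in auto)
  then have "\<bar>x k\<bar> \<le> s" unfolding G(3) by (intro cSup_upper) (use k in auto)
  then show "b \<le> s" using k by linarith
qed

text \<open>Only finitely many entries are at least as large as a given nonzero one, so the supremum
  inside \<open>xstar\<close> is a maximum. This drives the greedy selection in
  \<open>xstar_attained\<close>.\<close>

lemma null_seq_attains_max_off:
  fixes x :: "nat \<Rightarrow> real"
  assumes "x \<longlonglongrightarrow> 0" "finite F"
  shows "\<exists>k. k \<notin> F \<and> (\<forall>l. l \<notin> F \<longrightarrow> \<bar>x l\<bar> \<le> \<bar>x k\<bar>)"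
proof (cases "\<forall>l. l \<notin> F \<longrightarrow> x l = 0")
  case True
  obtain k where "k \<notin> F" using assms(2) ex_new_if_finite infinite_UNIV_nat by blast
  with True show ?thesis by auto
next
  case False
  then obtain l where l: "l \<notin> F" "x l \<noteq> 0" by blast
  let ?G = "{k. k \<notin> F \<and> \<bar>x l\<bar> \<le> \<bar>x k\<bar>}"
  have "\<forall>\<^sub>F k in sequentially. \<bar>x k\<bar> < \<bar>x l\<bar>"
    using tendstoD[OF assms(1), of "\<bar>x l\<bar>"] l by (simp add: dist_real_def)
  then obtain M where M: "\<And>k. k \<ge> M \<Longrightarrow> \<bar>x k\<bar> < \<bar>x l\<bar>" by (auto simp: eventually_sequentially)
  have "?G \<subseteq> {..<M}"
  proof
    fix k assume "k \<in> ?G"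
    then show "k \<in> {..<M}" using M[of k] by (cases "k < M") auto
  qed
  then have fin: "finite ?G" by (rule finite_subset) simp
  obtain k where k: "k \<in> ?G" "\<And>m. m \<in> ?G \<Longrightarrow> \<bar>x m\<bar> \<le> \<bar>x k\<bar>"
  proof -
    have m: "Max ((\<lambda>k. \<bar>x k\<bar>) ` ?G) \<in> (\<lambda>k. \<bar>x k\<bar>) ` ?G" using fin l by (intro Max_in) auto
    then obtain k where "k \<in> ?G" "Max ((\<lambda>k. \<bar>x k\<bar>) ` ?G) = \<bar>x k\<bar>" by blast
    then show ?thesis using that[of k] fin by (metis (no_types, lifting) Max_ge finite_imageI imageI)
  qed
  have "\<bar>x m\<bar> \<le> \<bar>x k\<bar>" if "m \<notin> F" for m
    using that k(1) k(2)[of m] by (cases "\<bar>x l\<bar> \<le> \<bar>x m\<bar>") auto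
  then show ?thesis using k(1) by blast
qed

text \<open>Greedy choice of a largest remaining entry. The induction also records that each chosen
  entry dominates all entries not chosen.\<close>

lemma xstar_attained:
  fixes x :: "nat \<Rightarrow> real"
  assumes "x \<longlonglongrightarrow> 0"
  obtains \<sigma> where "inj_on \<sigma> {..<N}" "\<And>i. i < N \<Longrightarrow> \<bar>x (\<sigma> i)\<bar> = xstar x i"
proof -
  have "\<exists>\<sigma>. inj_on \<sigma> {..<N} \<and> (\<forall>i<N. \<bar>x (\<sigma> i)\<bar> = xstar x i) \<and>
    (\<forall>i<N. \<forall>k. k \<notin> \<sigma> ` {..<N} \<longrightarrow> \<bar>x k\<bar> \<le> \<bar>x (\<sigma> i)\<bar>)"
  proof (induction N)
    case 0
    then show ?case by auto
  next
    case (Suc N)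
    then obtain \<sigma> where \<sigma>: "inj_on \<sigma> {..<N}" "\<And>i. i<N \<Longrightarrow> \<bar>x (\<sigma> i)\<bar> = xstar x i"
      "\<And>i k. i<N \<Longrightarrow> k \<notin> \<sigma> ` {..<N} \<Longrightarrow> \<bar>x k\<bar> \<le> \<bar>x (\<sigma> i)\<bar>" by blast
    obtain k where k: "k \<notin> \<sigma> ` {..<N}" "\<And>l. l \<notin> \<sigma> ` {..<N} \<Longrightarrow> \<bar>x l\<bar> \<le> \<bar>x k\<bar>"
      using null_seq_attains_max_off[OF assms, of "\<sigma> ` {..<N}"] by blast
    define \<tau> where "\<tau> = \<sigma>(N := k)"
    have im: "\<tau> ` {..<Suc N} = insert k (\<sigma> ` {..<N})" unfolding \<tau>_def by (auto simp: lessThan_Suc)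
    have inj: "inj_on \<tau> {..<Suc N}"
      using \<sigma>(1) k(1) unfolding \<tau>_def lessThan_Suc by (auto simp: inj_on_def)
    have bx: "Bseq x" using assms convergentI convergent_imp_Bseq by blast
    have up: "xstar x N \<le> \<bar>x k\<bar>"
      by (rule xstar_le[of "\<sigma> ` {..<N}"]) (use k bx card_image_le[of "{..<N}" \<sigma>] in auto)
    have lo: "\<bar>x k\<bar> \<le> xstar x N"
    proof (rule xstar_ge[OF _ bx])
      fix F :: "nat set" assume F: "finite F" "card F \<le> N"
      \<comment> \<open>Pigeonhole: the \<open>Suc N\<close> chosen positions all carry modulus at
        least that of \<open>x k\<close>, and a set of at most \<open>N\<close> positions misses one
        of them.\<close>
      have "card (\<tau> ` {..<Suc N}) = Suc N" using card_image[OF inj] by simp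
      then have "\<not> \<tau> ` {..<Suc N} \<subseteq> F" using card_mono[OF F(1), of "\<tau> ` {..<Suc N}"] F(2) by linarith
      then obtain l where "l \<in> \<tau> ` {..<Suc N}" "l \<notin> F" by blast
      then show "\<exists>l. l \<notin> F \<and> \<bar>x k\<bar> \<le> \<bar>x l\<bar>" using im \<sigma>(3) k(1) by (intro exI[of _ l]) auto
    qed
    show ?case
    proof (intro exI conjI allI impI)
      show "inj_on \<tau> {..<Suc N}" by fact
      show "\<bar>x (\<tau> i)\<bar> = xstar x i" if "i < Suc N" for i
        using that up lo \<sigma>(2) by (cases "i = N") (auto simp: \<tau>_def)
      show "\<bar>x l\<bar> \<le> \<bar>x (\<tau> i)\<bar>" if "i < Suc N" "l \<notin> \<tau> ` {..<Suc N}" for i l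
        using that im k(2) \<sigma>(3) by (cases "i = N") (auto simp: \<tau>_def)
    qed
  qed
  then show ?thesis using that by blast
qed

text \<open>Induction by removing a smallest entry of \<open>A\<close>: fewer than
  \<open>card A\<close> positions cannot cover \<open>A\<close>, so this entry is at most the last
  rearranged value in the sum.\<close>

lemma sum_powr_le_sum_xstar:
  assumes "Bseq x" "finite A" "p \<ge> 0"
  shows "(\<Sum>k\<in>A. \<bar>x k\<bar> powr p) \<le> (\<Sum>i<card A. xstar x i powr p)"
  using assms(2)
proof (induction "card A" arbitrary: A)
  case 0
  then show ?case by simp
next
  case (Suc n)
  then have ne: "A \<noteq> {}" by auto
  obtain a where a: "a \<in> A" "\<And>k. k \<in> A \<Longrightarrow> \<bar>x a\<bar> \<le> \<bar>x k\<bar>"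
  proof -
    have "Min ((\<lambda>k. \<bar>x k\<bar>) ` A) \<in> (\<lambda>k. \<bar>x k\<bar>) ` A" using Suc.prems ne by (intro Min_in) auto
    then obtain a where "a \<in> A" "Min ((\<lambda>k. \<bar>x k\<bar>) ` A) = \<bar>x a\<bar>" by blast
    then show ?thesis using that[of a] Suc.prems by (metis (no_types, lifting) Min_le finite_imageI imageI)
  qed
  have "\<bar>x a\<bar> \<le> xstar x n"
  proof (rule xstar_ge[OF _ assms(1)])
    fix F :: "nat set" assume "finite F" "card F \<le> n"
    then have "\<not> A \<subseteq> F" using card_mono[of F A] Suc.hyps(2) by linarith
    then show "\<exists>k. k \<notin> F \<and> \<bar>x a\<bar> \<le> \<bar>x k\<bar>" using a by blast
  qed
  then have "\<bar>x a\<bar> powr p \<le> xstar x n powr p" using assms(3) by (intro powr_mono2) auto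
  moreover have "(\<Sum>k\<in>A - {a}. \<bar>x k\<bar> powr p) \<le> (\<Sum>i<n. xstar x i powr p)"
  proof -
    have c: "n = card (A - {a})" using Suc.hyps(2)[symmetric] Suc.prems a by simp
    show ?thesis using Suc.hyps(1)[OF c] Suc.prems c by simp
  qed
  ultimately show ?case
    using sum.remove[OF Suc.prems a(1), of "\<lambda>k. \<bar>x k\<bar> powr p"] Suc.hyps(2)[symmetric] by simp
qed

text \<open>Abel summation. The induction shows more, namely that the weighted sum of differences
  dominates \<open>w n\<close> times the plain one; as plain partial sums are nonnegative,
  \<open>w n\<close> may be lowered to \<open>w (Suc n)\<close>.\<close>

lemma weighted_sum_le:
  fixes w a b :: "nat \<Rightarrow> real"
  assumes "decseq w" "\<And>n. 0 \<le> w n" "\<And>j. j \<le> N \<Longrightarrow> (\<Sum>i<j. a i) \<le> (\<Sum>i<j. b i)"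
  shows "(\<Sum>i<N. w i * a i) \<le> (\<Sum>i<N. w i * b i)"
proof -
  have "w n * (\<Sum>i<n. b i - a i) \<le> (\<Sum>i<n. w i * (b i - a i))" if "n \<le> N" for n
    using that
  proof (induction n)
    case (Suc n)
    have "0 \<le> (\<Sum>i<Suc n. b i - a i)" using assms(3)[OF Suc.prems] by (simp only: sum_subtractf)
    then have "w (Suc n) * (\<Sum>i<Suc n. b i - a i) \<le> w n * (\<Sum>i<Suc n. b i - a i)"
      using assms(1) by (intro mult_right_mono) (auto simp: decseq_Suc_iff)
    then show ?case using Suc by (simp add: algebra_simps)
  qed simp
  from this[of N] have "w N * (\<Sum>i<N. b i - a i) \<le> (\<Sum>i<N. w i * (b i - a i))" by simp
  moreover have "0 \<le> w N * (\<Sum>i<N. b i - a i)" using assms(2,3) by (simp add: sum_subtractf)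
  ultimately show ?thesis by (simp add: sum_subtractf algebra_simps)
qed

lemma xstar_nonneg:
  assumes "Bseq x"
  shows "0 \<le> xstar x n"
proof (rule xstar_ge[OF _ assms])
  fix F :: "nat set" assume "finite F"
  then obtain k where "k \<notin> F" using ex_new_if_finite infinite_UNIV_nat by blast
  then show "\<exists>k. k \<notin> F \<and> 0 \<le> \<bar>x k\<bar>" by auto
qed

lemma xstar_mono:
  assumes "\<And>k. \<bar>x k\<bar> \<le> \<bar>y k\<bar>" "y \<longlonglongrightarrow> 0"
  shows "xstar x n \<le> xstar y n"
proof -
  have bdy: "Bseq y" using assms(2) convergentI convergent_imp_Bseq by blast
  then obtain K where K: "\<And>k. \<bar>y k\<bar> \<le> K" by (auto simp: Bseq_def)
  have bx: "Bseq x" using order_trans[OF assms(1) K] by (intro BseqI'[of _ K]) auto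
  show ?thesis
    unfolding xstar_def[of y]
  proof (rule cInf_greatest)
    show "{Sup {\<bar>y k\<bar> | k. k \<notin> G} | G. finite G \<and> card G \<le> n} \<noteq> {}" by (auto intro!: exI[of _ "{}"])
    fix s assume "s \<in> {Sup {\<bar>y k\<bar> | k. k \<notin> G} | G. finite G \<and> card G \<le> n}"
    then obtain G where G: "finite G" "card G \<le> n" "s = Sup {\<bar>y k\<bar> | k. k \<notin> G}" by auto
    have "bdd_above {\<bar>y k\<bar> | k. k \<notin> G}" by (rule bdd_aboveI[of _ K]) (use K in auto)
    then have "\<bar>y k\<bar> \<le> s" if "k \<notin> G" for k unfolding G(3) by (intro cSup_upper) (use that in auto)
    then show "xstar x n \<le> s" using order_trans[OF assms(1)] xstar_le[OF G(1,2) _ bx] by blast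
  qed
qed

text \<open>Positive arguments are covered by \<open>powr_convex\<close>; if one argument is 0, the
  inequality reduces to \<open>c powr p \<le> c\<close> for \<open>0 < c < 1\<close>.\<close>

lemma convex_on_powr_nonneg:
  fixes p :: real
  assumes "1 \<le> p"
  shows "convex_on {0..} (\<lambda>x. x powr p)"
proof (rule convex_onI)
  fix t x y :: real assume t: "0 < t" "t < 1" and xy: "x \<in> {0..}" "y \<in> {0..}"
  have le: "c powr p \<le> c" if "0 < c" "c < 1" for c :: real
    using powr_mono'[OF assms, of c] that by (simp only: powr_one less_imp_le)
  consider "x = 0" | "y = 0" | "0 < x" "0 < y" using xy by fastforce
  then show "((1 - t) *\<^sub>R x + t *\<^sub>R y) powr p \<le> (1 - t) * x powr p + t * y powr p"
  proof cases
    case 1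
    have "t powr p * y powr p \<le> t * y powr p" using le[of t] t by (intro mult_right_mono) auto
    then show ?thesis using 1 t xy assms powr_mult[of t y p] by simp
  next
    case 2
    have "(1 - t) powr p * x powr p \<le> (1 - t) * x powr p" using le[of "1 - t"] t by (intro mult_right_mono) auto
    then show ?thesis using 2 t xy assms powr_mult[of "1 - t" x p] by simp
  next
    case 3
    then show ?thesis using convex_onD[OF powr_convex[OF assms], of t x y] t by simp
  qed
qed simp

text \<open>Convexity applied to \<open>(\<bar>a\<bar> + \<bar>b\<bar>) / (s + t)\<close>, a convex
  combination of \<open>\<bar>a\<bar> / s\<close> and \<open>\<bar>b\<bar> / t\<close>. Summed
  against the weights, with \<open>s\<close> and \<open>t\<close> bounding the two norms, it gives
  Minkowski's inequality.\<close>

lemma powr_add_le_weighted: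
  fixes a b s t :: real
  assumes "1 \<le> p" "0 < s" "0 < t"
  shows "\<bar>a + b\<bar> powr p \<le> (s + t) powr p *
    (s / (s + t) * (\<bar>a\<bar> powr p / s powr p) + t / (s + t) * (\<bar>b\<bar> powr p / t powr p))"
proof -
  have cv: "convex_on {0..} (\<lambda>x::real. x powr p)" using assms(1) by (rule convex_on_powr_nonneg)
  define u where "u = t / (s + t)"
  have u: "0 \<le> u" "u \<le> 1" "1 - u = s / (s + t)"
    using assms diff_divide_distrib[of "s + t" t "s + t"] by (simp_all add: u_def)
  have "((1 - u) * (\<bar>a\<bar> / s) + u * (\<bar>b\<bar> / t)) powr p
      \<le> (1 - u) * (\<bar>a\<bar> / s) powr p + u * (\<bar>b\<bar> / t) powr p"
    using convex_onD[OF cv u(1,2), of "\<bar>a\<bar> / s" "\<bar>b\<bar> / t"] assms by simp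
  moreover have "(1 - u) * (\<bar>a\<bar> / s) + u * (\<bar>b\<bar> / t) = (\<bar>a\<bar> + \<bar>b\<bar>) / (s + t)"
    using assms unfolding u(3) by (simp add: u_def add_divide_distrib)
  ultimately have "(\<bar>a\<bar> + \<bar>b\<bar>) powr p / (s + t) powr p
     \<le> (s / (s + t) * (\<bar>a\<bar> powr p / s powr p) + t / (s + t) * (\<bar>b\<bar> powr p / t powr p))"
    using assms unfolding u(3) by (simp add: powr_divide u_def)
  then have "(\<bar>a\<bar> + \<bar>b\<bar>) powr p \<le> (s + t) powr p *
    (s / (s + t) * (\<bar>a\<bar> powr p / s powr p) + t / (s + t) * (\<bar>b\<bar> powr p / t powr p))"
    using assms by (subst (asm) pos_divide_le_eq) (auto simp: mult.commute)
  moreover have "\<bar>a + b\<bar> powr p \<le> (\<bar>a\<bar> + \<bar>b\<bar>) powr p" using assms by (intro powr_mono2) auto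
  ultimately show ?thesis by linarith
qed

lemma filterlim_sequentially_inj:
  assumes "inj (\<tau> :: nat \<Rightarrow> nat)"
  shows "filterlim \<tau> sequentially sequentially"
  unfolding filterlim_at_top
proof
  fix Z :: nat
  have "finite {k. \<tau> k < Z}"
    using finite_vimageI[of "{..<Z}" \<tau>] assms by (simp add: vimage_def)
  then obtain M where M: "{k. \<tau> k < Z} \<subseteq> {..<M}" using finite_nat_iff_bounded by blast
  show "\<forall>\<^sub>F k in sequentially. Z \<le> \<tau> k"
  proof (rule eventually_sequentiallyI[of M])
    fix k assume "M \<le> k"
    then have "k \<notin> {k. \<tau> k < Z}" using M by auto
    then show "Z \<le> \<tau> k" by simp
  qed
qed

section \<open>The Lorentz norm\<close>

definition restr :: "nat set \<Rightarrow> (nat \<Rightarrow> real) \<Rightarrow> nat \<Rightarrow> real" where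
  "restr A x = (\<lambda>k. if k \<in> A then x k else 0)"

lemma restr_apply: "restr A x k = (if k \<in> A then x k else 0)"
  by (simp add: restr_def)

locale lorentz =
  fixes w :: "nat \<Rightarrow> real" and p :: real
  assumes p1: "1 \<le> p" and w0: "w 0 = 1" and dec: "decseq w"
    and wnull: "w \<longlonglongrightarrow> 0" and wdiv: "\<not> summable w"
begin

abbreviation nrm :: "(nat \<Rightarrow> real) \<Rightarrow> real" where "nrm \<equiv> lorentz_norm w p"
abbreviation dwp :: "(nat \<Rightarrow> real) set" where "dwp \<equiv> lorentz_space w p"

lemma w_nonneg: "0 \<le> w n"
  using decseq_ge[OF dec wnull] .

lemma p_pos: "0 < p"
  using p1 by simp

lemma nrm_nonneg: "0 \<le> nrm x"
  by (simp add: lorentz_norm_def)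

lemma dwp_tendsto: "x \<in> dwp \<Longrightarrow> x \<longlonglongrightarrow> 0"
  by (simp add: lorentz_space_def)

lemma weighted_powr_nonneg: "0 \<le> w i * t powr p"
  using w_nonneg by simp

lemma nrm_powr: "x \<in> dwp \<Longrightarrow> nrm x powr p = (\<Sum>n. w n * xstar x n powr p)"
  using p1 suminf_nonneg[of "\<lambda>n. w n * xstar x n powr p"] weighted_powr_nonneg
  by (auto simp: lorentz_norm_def lorentz_space_def powr_powr)

section \<open>The norm as a supremum over finite injective selections\<close>

lemma rearrangement_sum_le:
  assumes "x \<longlonglongrightarrow> 0" "inj_on \<sigma> {..<N}"
  shows "(\<Sum>i<N. w i * \<bar>x (\<sigma> i)\<bar> powr p) \<le> (\<Sum>i<N. w i * xstar x i powr p)"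
proof (rule weighted_sum_le[OF dec w_nonneg])
  fix j assume "j \<le> N"
  then have inj: "inj_on \<sigma> {..<j}" using assms(2) by (auto intro: inj_on_subset)
  have "Bseq x" using assms convergentI convergent_imp_Bseq by blast
  from sum_powr_le_sum_xstar[OF this, of "\<sigma> ` {..<j}" p] inj p_pos
  show "(\<Sum>i<j. \<bar>x (\<sigma> i)\<bar> powr p) \<le> (\<Sum>i<j. xstar x i powr p)"
    by (simp add: sum.reindex card_image)
qed

text \<open>Together with \<open>sum_le_nrm\<close> this describes the \<open>p\<close>-th power of
  the norm as the supremum of weighted sums over injective selections of positions, so that most
  later estimates avoid \<open>xstar\<close>.\<close>

lemma dwpI:
  assumes "x \<longlonglongrightarrow> 0" "0 \<le> C"
    and "\<And>N \<sigma>. inj_on \<sigma> {..<N} \<Longrightarrow> (\<Sum>i<N. w i * \<bar>x (\<sigma> i)\<bar> powr p) \<le> C powr p"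
  shows "x \<in> dwp" "nrm x \<le> C"
proof -
  have bd: "(\<Sum>i<N. w i * xstar x i powr p) \<le> C powr p" for N
  proof -
    obtain \<sigma> where s: "inj_on \<sigma> {..<N}" "\<And>i. i < N \<Longrightarrow> \<bar>x (\<sigma> i)\<bar> = xstar x i"
      using xstar_attained[OF assms(1)] by blast
    have "(\<Sum>i<N. w i * xstar x i powr p) = (\<Sum>i<N. w i * \<bar>x (\<sigma> i)\<bar> powr p)"
      by (rule sum.cong) (use s in auto)
    then show ?thesis using assms(3)[OF s(1)] by simp
  qed
  have sm: "summable (\<lambda>n. w n * xstar x n powr p)"
    by (rule summableI_nonneg_bounded[OF weighted_powr_nonneg bd])
  then show x: "x \<in> dwp" using assms(1) by (simp add: lorentz_space_def)
  have "nrm x powr p \<le> C powr p"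
    unfolding nrm_powr[OF x] by (rule suminf_le_const[OF sm bd])
  then show "nrm x \<le> C" using assms(2) p_pos nrm_nonneg
    by (meson not_less powr_less_mono2)
qed

text \<open>The slots \<open>I\<close> may have gaps. This freedom is used for
  \<open>spread\<close>, and for stacking blocks into disjoint sets of slots in
  \<open>op_small_coordinates\<close>.\<close>

lemma sum_le_nrm:
  assumes x: "x \<in> dwp" and I: "finite I" and inj: "inj_on \<rho> I"
  shows "(\<Sum>i\<in>I. w i * \<bar>x (\<rho> i)\<bar> powr p) \<le> nrm x powr p"
proof -
  obtain N where N: "I \<subseteq> {..<N}" using I finite_nat_iff_bounded by blast
  obtain M where M: "\<rho> ` I \<subseteq> {..<M}" using I finite_nat_iff_bounded by blast
  define \<sigma> where "\<sigma> i = (if i \<in> I then \<rho> i else M + i)" for i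
  have s: "inj_on \<sigma> {..<N}"
  proof (rule inj_onI)
    fix i j assume "\<sigma> i = \<sigma> j"
    moreover have "i \<in> I \<Longrightarrow> \<rho> i < M" for i using M by auto
    ultimately show "i = j" using inj_onD[OF inj, of i j]
      by (auto simp: \<sigma>_def split: if_splits) (metis not_add_less1)+
  qed
  have "(\<Sum>i\<in>I. w i * \<bar>x (\<rho> i)\<bar> powr p) = (\<Sum>i\<in>I. w i * \<bar>x (\<sigma> i)\<bar> powr p)"
    by (rule sum.cong) (auto simp: \<sigma>_def)
  also have "\<dots> \<le> (\<Sum>i<N. w i * \<bar>x (\<sigma> i)\<bar> powr p)"
    by (rule sum_mono2) (use N weighted_powr_nonneg in auto)
  also have "\<dots> \<le> (\<Sum>i<N. w i * xstar x i powr p)"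
    by (rule rearrangement_sum_le[OF dwp_tendsto[OF x] s])
  also have "\<dots> \<le> nrm x powr p"
    unfolding nrm_powr[OF x]
    by (rule sum_le_suminf) (use x weighted_powr_nonneg in \<open>auto simp: lorentz_space_def\<close>)
  finally show ?thesis .
qed

text \<open>Position \<open>k\<close> is put into slot 0, whose weight is 1.\<close>

lemma abs_le_nrm: "x \<in> dwp \<Longrightarrow> \<bar>x k\<bar> \<le> nrm x"
  using sum_le_nrm[of x "{0}" "\<lambda>_. k"] w0 nrm_nonneg[of x] p_pos
  powr_less_mono2[of p "nrm x" "\<bar>x k\<bar>"]
  by (cases "nrm x < \<bar>x k\<bar>") auto

lemma dwp_mono:
  assumes "y \<in> dwp" "\<And>k. \<bar>x k\<bar> \<le> \<bar>y k\<bar>"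
  shows "x \<in> dwp" "nrm x \<le> nrm y"
proof -
  have x0: "x \<longlonglongrightarrow> 0"
    by (rule tendsto_0_le[OF dwp_tendsto[OF assms(1)], of _ 1]) (use assms in auto)
  have b: "(\<Sum>i<N. w i * \<bar>x (\<sigma> i)\<bar> powr p) \<le> nrm y powr p" if "inj_on \<sigma> {..<N}" for N \<sigma>
  proof -
    have "(\<Sum>i<N. w i * \<bar>x (\<sigma> i)\<bar> powr p) \<le> (\<Sum>i<N. w i * \<bar>y (\<sigma> i)\<bar> powr p)"
      using p_pos assms(2) w_nonneg by (intro sum_mono mult_left_mono powr_mono2) auto
    also have "\<dots> \<le> nrm y powr p" by (rule sum_le_nrm[OF assms(1) _ that]) simp
    finally show ?thesis .
  qed
  show "x \<in> dwp" by (rule dwpI(1)[OF x0 nrm_nonneg b])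
  show "nrm x \<le> nrm y" by (rule dwpI(2)[OF x0 nrm_nonneg b])
qed

section \<open>Linear structure, triangle inequality and tails\<close>

lemma restr_dwp: "x \<in> dwp \<Longrightarrow> restr A x \<in> dwp"
  by (erule dwp_mono(1)) (simp add: restr_apply)

lemma nrm_restr_le: "x \<in> dwp \<Longrightarrow> nrm (restr A x) \<le> nrm x"
  by (erule dwp_mono(2)) (simp add: restr_apply)

lemma scale_dwp:
  assumes "x \<in> dwp"
  shows "(\<lambda>k. a * x k) \<in> dwp" "nrm (\<lambda>k. a * x k) \<le> \<bar>a\<bar> * nrm x"
proof -
  have x0: "(\<lambda>k. a * x k) \<longlonglongrightarrow> 0" using dwp_tendsto[OF assms] tendsto_mult_right_zero by blast
  have b: "(\<Sum>i<N. w i * \<bar>a * x (\<sigma> i)\<bar> powr p) \<le> (\<bar>a\<bar> * nrm x) powr p" if "inj_on \<sigma> {..<N}" for N \<sigma>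
  proof -
    have "(\<Sum>i<N. w i * \<bar>a * x (\<sigma> i)\<bar> powr p) = \<bar>a\<bar> powr p * (\<Sum>i<N. w i * \<bar>x (\<sigma> i)\<bar> powr p)"
      by (simp add: abs_mult powr_mult sum_distrib_left mult_ac)
    also have "\<dots> \<le> \<bar>a\<bar> powr p * nrm x powr p"
      by (intro mult_left_mono sum_le_nrm[OF assms _ that]) auto
    finally show ?thesis by (simp add: powr_mult nrm_nonneg)
  qed
  show "(\<lambda>k. a * x k) \<in> dwp" by (rule dwpI(1)[OF x0 _ b]) (simp add: nrm_nonneg)
  show "nrm (\<lambda>k. a * x k) \<le> \<bar>a\<bar> * nrm x" by (rule dwpI(2)[OF x0 _ b]) (simp add: nrm_nonneg)
qed

lemma nrm_scale: "x \<in> dwp \<Longrightarrow> nrm (\<lambda>k. a * x k) = \<bar>a\<bar> * nrm x"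
proof (cases "a = 0")
  case True
  assume "x \<in> dwp"
  then show ?thesis using scale_dwp(2)[of x a] nrm_nonneg[of "\<lambda>k. a * x k"] True by simp
next
  case False
  assume x: "x \<in> dwp"
  have "nrm x \<le> \<bar>1 / a\<bar> * nrm (\<lambda>k. a * x k)"
    using scale_dwp(2)[OF scale_dwp(1)[OF x, of a], of "1 / a"] False by simp
  then have "\<bar>a\<bar> * nrm x \<le> nrm (\<lambda>k. a * x k)" using False by (simp add: field_simps)
  then show ?thesis using scale_dwp(2)[OF x, of a] by simp
qed

text \<open>The strict bounds force \<open>s\<close> and \<open>t\<close> to be positive, so
  dividing by them is safe even for vectors of norm 0; the triangle inequality follows by letting
  them decrease to the norms.\<close>

lemma add_dwp_nrm_le:
  assumes "x \<in> dwp" "y \<in> dwp" "nrm x < s" "nrm y < t"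
  shows "(\<lambda>k. x k + y k) \<in> dwp" "nrm (\<lambda>k. x k + y k) \<le> s + t"
proof -
  have s: "0 < s" "0 < t" using assms nrm_nonneg[of x] nrm_nonneg[of y] by linarith+
  have x0: "(\<lambda>k. x k + y k) \<longlonglongrightarrow> 0" using dwp_tendsto[OF assms(1)] dwp_tendsto[OF assms(2)]
      tendsto_add_zero by blast
  have b: "(\<Sum>i<N. w i * \<bar>x (\<sigma> i) + y (\<sigma> i)\<bar> powr p) \<le> (s + t) powr p" if inj: "inj_on \<sigma> {..<N}" for N \<sigma>
  proof -
    have le1: "(\<Sum>i<N. w i * \<bar>z (\<sigma> i)\<bar> powr p) / r powr p \<le> 1" if "z \<in> dwp" "nrm z < r" for z r
    proof -
      have "(\<Sum>i<N. w i * \<bar>z (\<sigma> i)\<bar> powr p) \<le> nrm z powr p"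
        by (rule sum_le_nrm[OF that(1) _ inj]) simp
      also have "\<dots> \<le> r powr p" using that nrm_nonneg p_pos by (intro powr_mono2) auto
      finally show ?thesis using that nrm_nonneg[of z] by (simp add: divide_le_eq)
    qed
    have "(\<Sum>i<N. w i * \<bar>x (\<sigma> i) + y (\<sigma> i)\<bar> powr p) \<le> (\<Sum>i<N. w i * ((s + t) powr p *
      (s / (s + t) * (\<bar>x (\<sigma> i)\<bar> powr p / s powr p) + t / (s + t) * (\<bar>y (\<sigma> i)\<bar> powr p / t powr p))))"
      by (intro sum_mono mult_left_mono w_nonneg powr_add_le_weighted p1 s)
    also have "\<dots> = (s + t) powr p * (s / (s + t) * ((\<Sum>i<N. w i * \<bar>x (\<sigma> i)\<bar> powr p) / s powr p)
       + t / (s + t) * ((\<Sum>i<N. w i * \<bar>y (\<sigma> i)\<bar> powr p) / t powr p))"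
      by (simp add: sum_distrib_left sum_divide_distrib sum.distrib[symmetric] distrib_left mult_ac)
    also have "\<dots> \<le> (s + t) powr p * (s / (s + t) * 1 + t / (s + t) * 1)"
      using s by (intro mult_left_mono add_mono le1 assms) auto
    also have "\<dots> = (s + t) powr p" using s by (simp add: add_divide_distrib[symmetric])
    finally show ?thesis .
  qed
  show "(\<lambda>k. x k + y k) \<in> dwp" by (rule dwpI(1)[OF x0 _ b]) (use s in simp)
  show "nrm (\<lambda>k. x k + y k) \<le> s + t" by (rule dwpI(2)[OF x0 _ b]) (use s in simp)
qed

lemma add_dwp: "x \<in> dwp \<Longrightarrow> y \<in> dwp \<Longrightarrow> (\<lambda>k. x k + y k) \<in> dwp"
  using add_dwp_nrm_le(1)[of x y "nrm x + 1" "nrm y + 1"] by simp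

lemma nrm_triangle:
  assumes "x \<in> dwp" "y \<in> dwp"
  shows "nrm (\<lambda>k. x k + y k) \<le> nrm x + nrm y"
proof (rule field_le_epsilon)
  fix e :: real assume "0 < e"
  then show "nrm (\<lambda>k. x k + y k) \<le> nrm x + nrm y + e"
    using add_dwp_nrm_le(2)[OF assms, of "nrm x + e/2" "nrm y + e/2"] by simp
qed

lemma diff_dwp: "x \<in> dwp \<Longrightarrow> y \<in> dwp \<Longrightarrow> (\<lambda>k. x k - y k) \<in> dwp"
  using add_dwp[of x "\<lambda>k. (-1) * y k"] scale_dwp(1)[of y "-1"] by simp

lemma nrm_triangle_le:
  assumes "x \<in> dwp" "y \<in> dwp"
  shows "nrm x \<le> nrm y + nrm (\<lambda>k. x k - y k)"
  using nrm_triangle[OF assms(2) diff_dwp[OF assms]] by simp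

lemma nrm_triangle_diff_le:
  assumes "x \<in> dwp" "y \<in> dwp"
  shows "nrm (\<lambda>k. x k - y k) \<le> nrm x + nrm y"
  using nrm_triangle[OF assms(1) scale_dwp(1)[OF assms(2), of "-1"]] nrm_scale[OF assms(2), of "-1"] by simp

lemma zero_dwp: "(\<lambda>k. 0) \<in> dwp" and nrm_zero: "nrm (\<lambda>k. 0) = 0"
proof -
  have s: "(\<Sum>i<N. w i * \<bar>(\<lambda>k. 0::real) (\<sigma> i)\<bar> powr p) \<le> 0 powr p" for \<sigma> :: "nat \<Rightarrow> nat" and N
    by simp
  show "(\<lambda>k. 0) \<in> dwp" "nrm (\<lambda>k. 0) = 0"
    using dwpI[of "\<lambda>k. 0" 0, OF _ _ s] nrm_nonneg[of "\<lambda>k. 0"] by auto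
qed

lemma sum_dwp: "(\<And>i. i \<in> A \<Longrightarrow> f i \<in> dwp) \<Longrightarrow> (\<lambda>k. \<Sum>i\<in>A. f i k) \<in> dwp"
  by (induction A rule: infinite_finite_induct) (auto intro: add_dwp zero_dwp)

lemma nrm_sum_le:
  "(\<And>i. i \<in> A \<Longrightarrow> f i \<in> dwp) \<Longrightarrow> nrm (\<lambda>k. \<Sum>i\<in>A. f i k) \<le> (\<Sum>i\<in>A. nrm (f i))"
proof (induction A rule: infinite_finite_induct)
  case (insert a A)
  have "nrm (\<lambda>k. f a k + (\<Sum>i\<in>A. f i k)) \<le> nrm (f a) + nrm (\<lambda>k. \<Sum>i\<in>A. f i k)"
    using insert by (intro nrm_triangle sum_dwp) auto
  then show ?case using insert by (fastforce)
qed (simp_all add: nrm_zero)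

text \<open>Slots from \<open>M\<close> on are controlled by the tail of the convergent series for
  \<open>x\<close>; the first \<open>M\<close> slots are controlled by the uniform smallness of the
  late entries.\<close>

lemma tail_small:
  assumes "x \<in> dwp" "0 < e"
  shows "\<exists>m0. \<forall>m\<ge>m0. nrm (restr {m..} x) \<le> e"
proof -
  let ?f = "\<lambda>n. w n * xstar x n powr p"
  have sm: "summable ?f" using assms by (simp add: lorentz_space_def)
  have ep: "0 < e powr p" using assms by simp
  obtain M where M: "norm (\<Sum>i. ?f (i + M)) < e powr p / 2"
    using suminf_exist_split[of "e powr p / 2" ?f] sm ep by auto
  \<comment> \<open>Chosen so that \<open>M\<close> slots of weight at most 1 contribute at most
    half of \<open>e powr p\<close>; the summand 1 covers \<open>M = 0\<close>.\<close>
  define \<eta> where "\<eta> = (e powr p / 2 / (real M + 1)) powr (1 / p)"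
  have eta: "0 < \<eta>" "\<eta> powr p = e powr p / 2 / (real M + 1)"
    using ep p_pos by (auto simp: \<eta>_def powr_powr)
  obtain m0 where m0: "\<And>k. k \<ge> m0 \<Longrightarrow> \<bar>x k\<bar> < \<eta>"
    using LIMSEQ_D[OF dwp_tendsto[OF assms(1)] eta(1)] by auto
  have "nrm (restr {m..} x) \<le> e" if "m \<ge> m0" for m
  proof -
    let ?y = "restr {m..} x"
    have y: "?y \<in> dwp" using assms restr_dwp by blast
    let ?g = "\<lambda>n. w n * xstar ?y n powr p"
    have smg: "summable ?g" using y by (simp add: lorentz_space_def)
    have by0: "Bseq ?y" using dwp_tendsto[OF y] convergentI convergent_imp_Bseq by blast
    have nn: "0 \<le> xstar ?y i" for i using xstar_nonneg[OF by0] .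
    have le: "xstar ?y i \<le> xstar x i" for i
      by (rule xstar_mono[OF _ dwp_tendsto[OF assms(1)]]) (auto simp: restr_apply)
    have le2: "xstar ?y i \<le> \<eta>" for i
      by (rule xstar_le[of "{}", OF _ _ _ by0])
        (use m0 that eta(1) in \<open>auto simp: restr_apply less_imp_le\<close>)
    have w1: "w i \<le> 1" for i using decseqD[OF dec, of 0 i] w0 by simp
    have "?g i \<le> 1 * \<eta> powr p" for i
      using le2 nn w1 w_nonneg p_pos by (intro mult_mono powr_mono2) auto
    then have 1: "(\<Sum>i<M. ?g i) \<le> (\<Sum>i<M. \<eta> powr p)" by (intro sum_mono) simp
    have 1: "(\<Sum>i<M. ?g i) \<le> e powr p / 2"
    proof -
      have "real M * \<eta> powr p \<le> e powr p / 2" unfolding eta(2) using ep by (simp add: field_simps)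
      then show ?thesis using 1 by simp
    qed
    have 2: "(\<Sum>i. ?g (i + M)) \<le> (\<Sum>i. ?f (i + M))"
      using le nn w_nonneg p_pos sm smg
      by (intro suminf_le) (auto intro!: mult_left_mono powr_mono2
          summable_ignore_initial_segment[OF sm] summable_ignore_initial_segment[OF smg])
    have "nrm ?y powr p \<le> e powr p"
      unfolding nrm_powr[OF y] suminf_split_initial_segment[OF smg, of M] using 1 2 M by (simp add: abs_le_iff)
    then show ?thesis using assms(2) p_pos nrm_nonneg by (meson less_imp_le not_less powr_less_mono2)
  qed
  then show ?thesis by blast
qed

section \<open>Reindexing along injections\<close>

lemma reindex_dwp:
  assumes "x \<in> dwp" "inj \<tau>"
  shows "(\<lambda>k. x (\<tau> k)) \<in> dwp" "nrm (\<lambda>k. x (\<tau> k)) \<le> nrm x"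
proof -
  have x0: "(\<lambda>k. x (\<tau> k)) \<longlonglongrightarrow> 0"
    using filterlim_compose[OF dwp_tendsto[OF assms(1)] filterlim_sequentially_inj[OF assms(2)]] .
  have b: "(\<Sum>i<N. w i * \<bar>x (\<tau> (\<sigma> i))\<bar> powr p) \<le> nrm x powr p" if inj: "inj_on \<sigma> {..<N}" for N \<sigma>
    using sum_le_nrm[OF assms(1), of "{..<N}" "\<lambda>i. \<tau> (\<sigma> i)"] inj assms(2)
    by (simp add: inj_on_def inj_def)
  show "(\<lambda>k. x (\<tau> k)) \<in> dwp" by (rule dwpI(1)[OF x0 nrm_nonneg b])
  show "nrm (\<lambda>k. x (\<tau> k)) \<le> nrm x" by (rule dwpI(2)[OF x0 nrm_nonneg b])
qed

text \<open>For injective \<open>\<tau>\<close> this is the embedding that sends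
  \<open>unit_vec k\<close> to \<open>unit_vec (\<tau> k)\<close>; it maps the space onto its
  members supported in \<open>range \<tau>\<close>.\<close>

definition spread :: "(nat \<Rightarrow> nat) \<Rightarrow> (nat \<Rightarrow> real) \<Rightarrow> nat \<Rightarrow> real" where
  "spread \<tau> x = (\<lambda>k. if k \<in> range \<tau> then x (inv \<tau> k) else 0)"

lemma spread_apply: "inj \<tau> \<Longrightarrow> spread \<tau> x (\<tau> k) = x k"
  by (simp add: spread_def)

text \<open>In a selection from \<open>spread \<tau> x\<close>, positions off
  \<open>range \<tau>\<close> contribute 0, and the remaining slots give a selection from
  \<open>x\<close> with gaps. The reverse inequality comes from reindexing back along
  \<open>\<tau>\<close>.\<close>

lemma spread_dwp:
  assumes "x \<in> dwp" "inj \<tau>"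
  shows "spread \<tau> x \<in> dwp" "nrm (spread \<tau> x) = nrm x"
proof -
  have x0: "spread \<tau> x \<longlonglongrightarrow> 0"
  proof (rule LIMSEQ_I)
    fix r :: real assume r: "0 < r"
    obtain M where M: "\<And>k. k \<ge> M \<Longrightarrow> \<bar>x k\<bar> < r"
      using LIMSEQ_D[OF dwp_tendsto[OF assms(1)] r] by auto
    have "finite (\<tau> ` {..<M})" by simp
    then obtain m where m: "\<tau> ` {..<M} \<subseteq> {..<m}" using finite_nat_iff_bounded by blast
    have "\<bar>spread \<tau> x k\<bar> < r" if k: "k \<ge> m" for k
    proof (cases "k \<in> range \<tau>")
      case True
      then obtain l where l: "k = \<tau> l" by blast
      have "l \<notin> {..<M}" using m k l by auto
      then have "l \<ge> M" by simp
      then show ?thesis using l M[of l] assms by (simp add: spread_apply)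
    next
      case False
      then show ?thesis using r by (simp add: spread_def)
    qed
    then show "\<exists>no. \<forall>n\<ge>no. norm (spread \<tau> x n - 0) < r" by auto
  qed
  have b: "(\<Sum>i<N. w i * \<bar>spread \<tau> x (\<sigma> i)\<bar> powr p) \<le> nrm x powr p" if inj: "inj_on \<sigma> {..<N}" for N \<sigma>
  proof -
    let ?I = "{i. i < N \<and> \<sigma> i \<in> range \<tau>}"
    have "(\<Sum>i<N. w i * \<bar>spread \<tau> x (\<sigma> i)\<bar> powr p) = (\<Sum>i\<in>?I. w i * \<bar>x (inv \<tau> (\<sigma> i))\<bar> powr p)"
      by (rule sum.mono_neutral_cong_right) (auto simp: spread_def)
    also have "\<dots> \<le> nrm x powr p"
    proof (rule sum_le_nrm[OF assms(1)])
      show "inj_on (\<lambda>i. inv \<tau> (\<sigma> i)) ?I"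
      proof (rule inj_onI)
        fix i j assume ij: "i \<in> ?I" "j \<in> ?I" "inv \<tau> (\<sigma> i) = inv \<tau> (\<sigma> j)"
        then have "\<sigma> i = \<sigma> j" by (metis (mono_tags, lifting) f_inv_into_f mem_Collect_eq)
        then show "i = j" using inj_onD[OF inj, of i j] ij by simp
      qed
    qed simp
    finally show ?thesis .
  qed
  show s: "spread \<tau> x \<in> dwp"
    by (rule dwpI(1)[OF x0 nrm_nonneg b])
  have "nrm (spread \<tau> x) \<le> nrm x"
    by (rule dwpI(2)[OF x0 nrm_nonneg b])
  moreover have "nrm x \<le> nrm (spread \<tau> x)"
    using reindex_dwp(2)[OF s assms(2)] assms(2) by (simp add: spread_apply)
  ultimately show "nrm (spread \<tau> x) = nrm x" by simp
qed

text \<open>The rearrangement vanishes from index \<open>card A\<close> on, so only the first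
  \<open>card A\<close> weights enter the norm.\<close>

lemma finite_support_dwp:
  assumes "finite A" "\<And>k. k \<notin> A \<Longrightarrow> y k = 0"
  shows "y \<in> dwp"
    and "(\<And>k. \<bar>y k\<bar> \<le> 1) \<Longrightarrow> nrm y powr p \<le> (\<Sum>i<card A. w i)"
proof -
  have y0: "y \<longlonglongrightarrow> 0"
  proof (rule tendsto_eventually)
    obtain M where "A \<subseteq> {..<M}" using assms(1) finite_nat_iff_bounded by blast
    then show "\<forall>\<^sub>F k in sequentially. y k = 0"
      by (intro eventually_sequentiallyI[of M] assms(2)) auto
  qed
  then have bs: "Bseq y" using convergentI convergent_imp_Bseq by blast
  have z: "xstar y i = 0" if "card A \<le> i" for i
  proof (rule antisym)
    show "xstar y i \<le> 0" by (rule xstar_le[OF assms(1) that _ bs]) (simp add: assms(2))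
  qed (rule xstar_nonneg[OF bs])
  have zz: "w i * xstar y i powr p = 0" if "i \<notin> {..<card A}" for i using z that by simp
  have "summable (\<lambda>i. w i * xstar y i powr p)"
    by (rule summable_finite[OF finite_lessThan zz])
  then show y: "y \<in> dwp" using y0 by (simp add: lorentz_space_def)
  assume y1: "\<And>k. \<bar>y k\<bar> \<le> 1"
  have le: "xstar y i \<le> 1" for i by (rule xstar_le[of "{}", OF _ _ _ bs]) (use y1 in auto)
  have "nrm y powr p = (\<Sum>i<card A. w i * xstar y i powr p)"
    unfolding nrm_powr[OF y] by (rule suminf_finite[OF finite_lessThan zz])
  also have "\<dots> \<le> (\<Sum>i<card A. w i * 1)"
    using le xstar_nonneg[OF bs] p_pos w_nonneg
    by (intro sum_mono mult_left_mono) (auto intro: powr_le1)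
  finally show "nrm y powr p \<le> (\<Sum>i<card A. w i)" by simp
qed

lemma unit_vec_dwp: "unit_vec n \<in> dwp" and nrm_unit_vec: "nrm (unit_vec n) = 1"
proof -
  have z: "k \<notin> {n} \<Longrightarrow> unit_vec n k = 0" for k by (simp add: unit_vec_def)
  show u: "unit_vec n \<in> dwp" by (rule finite_support_dwp(1)[of "{n}", OF _ z]) auto
  have "nrm (unit_vec n) powr p \<le> 1 powr p"
    using finite_support_dwp(2)[of "{n}", OF _ z] w0 by (simp add: unit_vec_def)
  then have "nrm (unit_vec n) \<le> 1"
    by (meson not_less p_pos powr_less_mono2 zero_le_one)
  moreover have "1 \<le> nrm (unit_vec n)" using abs_le_nrm[OF u, of n] by (simp add: unit_vec_def)
  ultimately show "nrm (unit_vec n) = 1" by simp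
qed

text \<open>Cesaro means of the null sequence \<open>w\<close> tend to 0. This growth rate is what
  contradicts the linear lower bounds in \<open>op_coordinate_null\<close> and
  \<open>op_small_coordinates\<close>.\<close>

lemma weight_sum_sublinear:
  assumes "0 < e"
  shows "\<forall>\<^sub>F N in sequentially. (\<Sum>i<N. w i) \<le> e * real N"
proof -
  obtain M where M: "\<And>i. i \<ge> M \<Longrightarrow> w i < e / 2"
    using LIMSEQ_D[OF wnull, of "e/2"] assms by force
  have w1: "w i \<le> 1" for i using decseqD[OF dec, of 0 i] w0 by simp
  have b: "(\<Sum>i<N. w i) \<le> real M + e / 2 * real N" for N
  proof -
    have "(\<Sum>i<N. w i) \<le> (\<Sum>i<N. (if i < M then 1 else 0) + e / 2)"
    proof (rule sum_mono)
      fix i show "w i \<le> (if i < M then 1 else 0) + e / 2"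
        using M[of i] w1[of i] assms by (cases "i < M") auto
    qed
    also have "\<dots> = real (card {i. i < N \<and> i < M}) + e / 2 * real N"
      by (simp add: sum.distrib sum.If_cases Int_def)
    also have "card {i. i < N \<and> i < M} \<le> card {..<M}" by (rule card_mono) auto
    finally show ?thesis by simp
  qed
  obtain N0 :: nat where N0: "real M / (e / 2) \<le> real N0" using real_arch_simple by blast
  show ?thesis
  proof (rule eventually_sequentiallyI[of N0])
    fix N assume "N0 \<le> N"
    then have "real M / (e / 2) \<le> real N" using N0 by linarith
    then have "real M \<le> e / 2 * real N" using assms by (simp add: field_simps)
    then show "(\<Sum>i<N. w i) \<le> e * real N" using b[of N] by (simp add: field_simps)
  qed
qed

lemma weight_sum_unbounded: "\<exists>N. B < (\<Sum>i<N. w i)"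
  using summableI_nonneg_bounded[of w B, OF w_nonneg] wdiv by (meson not_less)

section \<open>Bounded operators\<close>

lemma op_dwp: "lorentz_operator w p S \<Longrightarrow> x \<in> dwp \<Longrightarrow> S x \<in> dwp"
  by (simp add: lorentz_operator_def)

lemma op_add: "lorentz_operator w p S \<Longrightarrow> x \<in> dwp \<Longrightarrow> y \<in> dwp \<Longrightarrow>
    S (\<lambda>k. x k + y k) = (\<lambda>k. S x k + S y k)"
  by (simp add: lorentz_operator_def linear_on_def)

lemma op_scale: "lorentz_operator w p S \<Longrightarrow> x \<in> dwp \<Longrightarrow> S (\<lambda>k. a * x k) = (\<lambda>k. a * S x k)"
  by (simp add: lorentz_operator_def linear_on_def)

lemma op_bounded:
  assumes "lorentz_operator w p S"
  obtains C where "0 < C" "\<And>x. x \<in> dwp \<Longrightarrow> nrm (S x) \<le> C * nrm x"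
proof -
  obtain C where C: "\<And>x. x \<in> dwp \<Longrightarrow> nrm (S x) \<le> C * nrm x"
    using assms by (auto simp: lorentz_operator_def)
  show ?thesis
  proof (rule that[of "max C 1"])
    fix x assume "x \<in> dwp"
    then show "nrm (S x) \<le> max C 1 * nrm x"
      using C[of x] mult_right_mono[of C "max C 1" "nrm x"] nrm_nonneg[of x] by simp
  qed simp
qed

lemma op_sum:
  assumes "lorentz_operator w p S" "finite A" "\<And>i. i \<in> A \<Longrightarrow> f i \<in> dwp"
  shows "S (\<lambda>k. \<Sum>i\<in>A. f i k) = (\<lambda>k. \<Sum>i\<in>A. S (f i) k)"
  using assms(2,3)
proof (induction A rule: finite_induct)
  case empty
  show ?case using op_scale[OF assms(1) zero_dwp, of 0] by simp
next
  case (insert a A)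
  then show ?case using op_add[OF assms(1), of "f a" "\<lambda>k. \<Sum>i\<in>A. f i k"] sum_dwp[of A f] by simp
qed

section \<open>Operators on finitely supported vectors\<close>

lemma restr_finite: "finite A \<Longrightarrow> restr A x = (\<lambda>k. \<Sum>n\<in>A. x n * unit_vec n k)"
  by (auto simp: restr_def unit_vec_def fun_eq_iff if_distrib[of "(*) _"] sum.delta cong: if_cong)

lemma op_restr_finite:
  assumes "lorentz_operator w p S" "finite A"
  shows "S (restr A x) = (\<lambda>k. \<Sum>n\<in>A. x n * S (unit_vec n) k)"
proof -
  have "S (restr A x) = (\<lambda>k. \<Sum>n\<in>A. S (\<lambda>k. x n * unit_vec n k) k)"
    unfolding restr_finite[OF assms(2)] by (rule op_sum[OF assms]) (simp add: scale_dwp(1) unit_vec_dwp)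
  then show ?thesis by (simp add: op_scale[OF assms(1) unit_vec_dwp])
qed

lemma nrm_op_restr_finite_le:
  assumes "lorentz_operator w p S" "finite A"
  shows "nrm (S (restr A x)) \<le> (\<Sum>n\<in>A. \<bar>x n\<bar> * nrm (S (unit_vec n)))"
proof -
  have "nrm (\<lambda>k. \<Sum>n\<in>A. x n * S (unit_vec n) k) \<le> (\<Sum>n\<in>A. nrm (\<lambda>k. x n * S (unit_vec n) k))"
    by (rule nrm_sum_le) (simp add: scale_dwp(1) op_dwp[OF assms(1)] unit_vec_dwp)
  then show ?thesis
    by (simp add: op_restr_finite[OF assms] nrm_scale op_dwp[OF assms(1)] unit_vec_dwp)
qed

lemma op_id: "lorentz_operator w p (\<lambda>x. x)"
  by (auto simp: lorentz_operator_def linear_on_def intro: exI[of _ 1])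

lemma op_comp:
  assumes "lorentz_operator w p S" "lorentz_operator w p T"
  shows "lorentz_operator w p (\<lambda>x. T (S x))"
proof -
  obtain C where C: "\<And>x. x \<in> dwp \<Longrightarrow> nrm (S x) \<le> C * nrm x"
    using op_bounded[OF assms(1)] by blast
  obtain D where D: "0 < D" "\<And>x. x \<in> dwp \<Longrightarrow> nrm (T x) \<le> D * nrm x"
    using op_bounded[OF assms(2)] by blast
  have "nrm (T (S x)) \<le> (D * C) * nrm x" if "x \<in> dwp" for x
  proof -
    have "nrm (T (S x)) \<le> D * nrm (S x)" by (rule D(2)[OF op_dwp[OF assms(1) that]])
    also have "\<dots> \<le> D * (C * nrm x)" using C[OF that] D(1) by simp
    finally show ?thesis by simp
  qed
  then show ?thesis
    unfolding lorentz_operator_def linear_on_def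
    by (auto simp: op_add[OF assms(1)] op_add[OF assms(2)] op_scale[OF assms(1)] op_scale[OF assms(2)]
        op_dwp[OF assms(1)] op_dwp[OF assms(2)])
qed

lemma op_spread:
  assumes "inj \<tau>"
  shows "lorentz_operator w p (spread \<tau>)"
proof -
  have "spread \<tau> (\<lambda>k. x k + y k) = (\<lambda>k. spread \<tau> x k + spread \<tau> y k)"
    "spread \<tau> (\<lambda>k. a * x k) = (\<lambda>k. a * spread \<tau> x k)" for x y a
    by (auto simp: spread_def)
  moreover have "nrm (spread \<tau> x) \<le> 1 * nrm x" if "x \<in> dwp" for x
    using spread_dwp(2)[OF that assms] by simp
  ultimately show ?thesis
    unfolding lorentz_operator_def linear_on_def using spread_dwp(1)[OF _ assms] by blast
qed

lemma spread_unit_vec: "inj \<tau> \<Longrightarrow> spread \<tau> (unit_vec k) = unit_vec (\<tau> k)"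
  by (auto simp: spread_def unit_vec_def fun_eq_iff)

text \<open>If infinitely many images had \<open>j\<close>-th coordinate of modulus at least
  \<open>e\<close>, a sum of \<open>N\<close> unit vectors with matching signs would have an image
  of norm at least \<open>N * e\<close>, while boundedness allows only sublinear growth.\<close>

lemma op_coordinate_null:
  assumes "lorentz_operator w p S"
  shows "(\<lambda>n. S (unit_vec n) j) \<longlonglongrightarrow> 0"
proof (rule ccontr)
  assume "\<not> ?thesis"
  then obtain e where e: "0 < e" "\<And>n0. \<exists>n\<ge>n0. e \<le> \<bar>S (unit_vec n) j\<bar>"
    unfolding LIMSEQ_iff by (auto simp: not_less)
  obtain C where C: "0 < C" "\<And>x. x \<in> dwp \<Longrightarrow> nrm (S x) \<le> C * nrm x"
    using op_bounded[OF assms] by blast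
  have inf: "infinite {n. e \<le> \<bar>S (unit_vec n) j\<bar>}"
    unfolding infinite_nat_iff_unbounded_le using e(2) by auto
  have key: "real N * e \<le> C * (\<Sum>i<N. w i)" if "1 \<le> N" for N
  proof -
    obtain A where A: "finite A" "card A = N" "A \<subseteq> {n. e \<le> \<bar>S (unit_vec n) j\<bar>}"
      using infinite_arbitrarily_large[OF inf, of N] by auto
    define y where "y = restr A (\<lambda>n. sgn (S (unit_vec n) j))"
    have y: "y \<in> dwp" by (rule finite_support_dwp(1)[OF A(1)]) (simp add: y_def restr_apply)
    have ny: "nrm y powr p \<le> (\<Sum>i<N. w i)"
      unfolding A(2)[symmetric]
      by (rule finite_support_dwp(2)[OF A(1)]) (auto simp: y_def restr_apply sgn_if)
    \<comment> \<open>As the sum is at least 1, the bound on \<open>nrm y powr p\<close> also bounds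
      \<open>nrm y\<close> itself, without taking roots.\<close>
    have "w 0 \<le> (\<Sum>i<N. w i)" by (rule member_le_sum) (use that w_nonneg in auto)
    then have W: "1 \<le> (\<Sum>i<N. w i)" using w0 by simp
    have "nrm y \<le> (\<Sum>i<N. w i)"
    proof (cases "1 \<le> nrm y")
      case True
      then show ?thesis using ny powr_mono[OF p1 True] by simp
    next
      case False
      then show ?thesis using W by simp
    qed
    then have 1: "C * nrm y \<le> C * (\<Sum>i<N. w i)" using C(1) by simp
    have "real N * e \<le> (\<Sum>n\<in>A. \<bar>S (unit_vec n) j\<bar>)"
      using sum_mono[of A "\<lambda>_. e" "\<lambda>n. \<bar>S (unit_vec n) j\<bar>"] A by auto
    also have "\<dots> = (\<Sum>n\<in>A. sgn (S (unit_vec n) j) * S (unit_vec n) j)"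
      by (simp add: abs_sgn mult.commute)
    also have "\<dots> = S y j"
      unfolding y_def op_restr_finite[OF assms A(1)] by simp
    also have "\<dots> \<le> C * nrm y" using abs_le_nrm[OF op_dwp[OF assms y], of j] C(2)[OF y] by linarith
    finally show ?thesis using 1 by linarith
  qed
  have "\<forall>\<^sub>F N in sequentially. (\<Sum>i<N. w i) \<le> e / (2 * C) * real N"
    using e C by (intro weight_sum_sublinear) simp
  then obtain N0 where N0: "\<And>N. N0 \<le> N \<Longrightarrow> (\<Sum>i<N. w i) \<le> e / (2 * C) * real N"
    by (auto simp: eventually_sequentially)
  have "C * (\<Sum>i<Suc N0. w i) \<le> C * (e / (2 * C) * real (Suc N0))"
    by (rule mult_left_mono[OF N0]) (use C in auto)
  also have "\<dots> = e * real (Suc N0) / 2" using C by simp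
  finally have "real (Suc N0) * e \<le> e * real (Suc N0) / 2" using key[of "Suc N0"] by linarith
  moreover have "0 < e * real (Suc N0)" using e by simp
  ultimately show False by (simp only: mult.commute)
qed

text \<open>Finitely many coordinates, each null by \<open>op_coordinate_null\<close>; the triangle
  inequality is obtained by applying \<open>nrm_op_restr_finite_le\<close> to the identity
  operator.\<close>

lemma op_head_null:
  assumes "lorentz_operator w p S"
  shows "(\<lambda>n. nrm (restr {..<m} (S (unit_vec n)))) \<longlonglongrightarrow> 0"
proof (rule tendsto_sandwich[of "\<lambda>_. 0"])
  show "(\<lambda>n. \<Sum>j<m. \<bar>S (unit_vec n) j\<bar>) \<longlonglongrightarrow> 0"
    using tendsto_null_sum[of "{..<m}" "\<lambda>n j. \<bar>S (unit_vec n) j\<bar>"]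
      tendsto_rabs_zero[OF op_coordinate_null[OF assms]] by blast
  show "\<forall>\<^sub>F n in sequentially. nrm (restr {..<m} (S (unit_vec n))) \<le> (\<Sum>j<m. \<bar>S (unit_vec n) j\<bar>)"
    using nrm_op_restr_finite_le[OF op_id, of "{..<m}"] by (simp add: nrm_unit_vec)
qed (auto simp: nrm_nonneg)

section \<open>Small coordinates\<close>

text \<open>If the small coordinates of the images of the unit vectors kept norm at least \<open>\<delta>\<close>, they
  could be placed into ever later slots of the weight, so that sums of \<open>K\<close> images would have
  \<open>p\<close>-th power of the norm growing linearly in \<open>K\<close>, whereas boundedness of \<open>S\<close> only allows
  growth like \<open>w 0 + \<dots> + w (K - 1)\<close>, which is sublinear.\<close>
lemma op_small_coordinates:
  assumes S: "lorentz_operator w p S" and \<delta>: "0 < \<delta>"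
  shows "\<exists>\<epsilon>>0. \<forall>\<^sub>F n in sequentially.
    nrm (restr {k. \<bar>S (unit_vec n) k\<bar> \<le> \<epsilon>} (S (unit_vec n))) < \<delta>"
proof (rule ccontr)
  assume "\<not> ?thesis"
  then have neg: "\<exists>n\<ge>n0. \<delta> \<le> nrm (restr {k. \<bar>S (unit_vec n) k\<bar> \<le> \<epsilon>} (S (unit_vec n)))"
    if "0 < \<epsilon>" for \<epsilon> n0 using that unfolding eventually_sequentially by (meson not_less)
  have Se: "S (unit_vec n) \<in> dwp" for n by (rule op_dwp[OF S unit_vec_dwp])
  \<comment> \<open>Each new image will contribute more than \<open>2 * \<theta>\<close>; at most
    \<open>\<theta>\<close> is lost by giving up the slots below \<open>M\<close>, so more than
    \<open>\<theta>\<close> is gained.\<close>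
  define \<theta> where "\<theta> = (\<delta> / 2) powr p / 3"
  have \<theta>: "0 < \<theta>" "2 * \<theta> < (\<delta> / 2) powr p" using \<delta> by (auto simp: \<theta>_def)
  \<comment> \<open>\<open>I\<close> and \<open>\<sigma>\<close> witness a lower bound for the norm
    of the sum over \<open>A\<close>. The slack \<open>- 1\<close> makes the inequality strict from
    \<open>K = 0\<close> on, and strictness survives the small perturbation of the old slots by the
    next image.\<close>
  have claim: "\<exists>A I \<sigma>. finite A \<and> card A = K \<and> finite I \<and> inj_on \<sigma> I \<and>
    real K * \<theta> - 1 < (\<Sum>i\<in>I. w i * \<bar>\<Sum>n\<in>A. S (unit_vec n) (\<sigma> i)\<bar> powr p)" for K
  proof (induction K)
    case 0
    show ?case by (rule exI[of _ "{}"], rule exI[of _ "{}"]) auto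
  next
    case (Suc K)
    then obtain A I \<sigma> where A: "finite A" "card A = K" and I: "finite I" "inj_on \<sigma> I"
      and low: "real K * \<theta> - 1 < (\<Sum>i\<in>I. w i * \<bar>\<Sum>n\<in>A. S (unit_vec n) (\<sigma> i)\<bar> powr p)" by blast
    define y where "y = (\<lambda>j. \<Sum>n\<in>A. S (unit_vec n) j)"
    have y: "y \<in> dwp" unfolding y_def by (rule sum_dwp[OF Se])
    obtain M where M: "I \<subseteq> {..<M}" using I(1) finite_nat_iff_bounded by blast
    obtain m1 where m1: "\<sigma> ` I \<subseteq> {..<m1}" using I(1) finite_nat_iff_bounded by blast
    \<comment> \<open>With this choice, \<open>M\<close> slots holding entries of modulus at most
      \<open>2 * \<epsilon>\<close> cost at most \<open>\<theta>\<close>.\<close>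
    define \<epsilon> where "\<epsilon> = (\<theta> / (real M + 1)) powr (1 / p) / 2"
    have \<epsilon>: "0 < \<epsilon>" "(2 * \<epsilon>) powr p = \<theta> / (real M + 1)"
      using \<theta>(1) p_pos by (auto simp: \<epsilon>_def powr_powr)
    have "0 < min (\<delta> / 4) \<epsilon>" using \<delta> \<epsilon>(1) by simp
    from tail_small[OF y this] obtain m where m: "m1 \<le> m" "nrm (restr {m..} y) \<le> min (\<delta> / 4) \<epsilon>"
      by (meson max.cobounded1 max.cobounded2)
    have ysmall: "\<bar>y j\<bar> \<le> \<epsilon>" if "m \<le> j" for j
      using abs_le_nrm[OF restr_dwp[OF y], of "{m..}" j] m(2) that by (simp add: restr_apply)
    \<comment> \<open>The next image tends to 0 at the finitely many positions already in use, so
      the strict lower bound there persists for large \<open>n\<close>.\<close>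
    have "(\<lambda>n. \<Sum>i\<in>I. w i * \<bar>y (\<sigma> i) + S (unit_vec n) (\<sigma> i)\<bar> powr p) \<longlonglongrightarrow>
      (\<Sum>i\<in>I. w i * \<bar>y (\<sigma> i) + 0\<bar> powr p)"
      using p_pos by (intro tendsto_intros op_coordinate_null[OF S] tendsto_powr') auto
    then have "\<forall>\<^sub>F n in sequentially. real K * \<theta> - 1 < (\<Sum>i\<in>I. w i * \<bar>y (\<sigma> i) + S (unit_vec n) (\<sigma> i)\<bar> powr p)"
      by (rule order_tendstoD(1)) (use low in \<open>simp add: y_def\<close>)
    moreover have "\<forall>\<^sub>F n in sequentially. nrm (restr {..<m} (S (unit_vec n))) < \<delta> / 4"
      by (rule order_tendstoD(2)[OF op_head_null[OF S]]) (use \<delta> in simp)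
    moreover have "\<forall>\<^sub>F n in sequentially. n \<notin> A"
      using A(1) finite_nat_iff_bounded[of A] by (auto simp: eventually_sequentially subset_eq) (meson not_less)
    ultimately have "\<forall>\<^sub>F n in sequentially.
        real K * \<theta> - 1 < (\<Sum>i\<in>I. w i * \<bar>y (\<sigma> i) + S (unit_vec n) (\<sigma> i)\<bar> powr p) \<and>
        nrm (restr {..<m} (S (unit_vec n))) < \<delta> / 4 \<and> n \<notin> A" by eventually_elim auto
    then obtain n0 where n0: "\<And>n. n0 \<le> n \<Longrightarrow>
        real K * \<theta> - 1 < (\<Sum>i\<in>I. w i * \<bar>y (\<sigma> i) + S (unit_vec n) (\<sigma> i)\<bar> powr p) \<and>
        nrm (restr {..<m} (S (unit_vec n))) < \<delta> / 4 \<and> n \<notin> A"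
      by (auto simp: eventually_sequentially)
    obtain n where n: "n0 \<le> n"
      "\<delta> \<le> nrm (restr {k. \<bar>S (unit_vec n) k\<bar> \<le> \<epsilon>} (S (unit_vec n)))" using neg[OF \<epsilon>(1)] by blast
    define x where "x = S (unit_vec n)"
    have x: "x \<in> dwp" unfolding x_def by (rule Se)
    have xI: "real K * \<theta> - 1 < (\<Sum>i\<in>I. w i * \<bar>y (\<sigma> i) + x (\<sigma> i)\<bar> powr p)"
      and xm: "nrm (restr {..<m} x) < \<delta> / 4" and nA: "n \<notin> A" using n0[OF n(1)] by (auto simp: x_def)
    define G where "G = {j. m \<le> j \<and> \<bar>x j\<bar> \<le> \<epsilon>}"
    define z where "z = restr {k. \<bar>x k\<bar> \<le> \<epsilon>} x"
    define u where "u = restr G (\<lambda>j. y j + x j)"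
    have z: "z \<in> dwp" unfolding z_def by (rule restr_dwp[OF x])
    have u: "u \<in> dwp" unfolding u_def by (rule restr_dwp[OF add_dwp[OF y x]])
    \<comment> \<open>Both \<open>restr G y\<close> and the head of \<open>z\<close> have norm at
      most \<open>\<delta> / 4\<close>, so \<open>u\<close>, which lives on new positions, keeps
      norm at least \<open>\<delta> / 2\<close>.\<close>
    have "z = (\<lambda>j. (u j - restr G y j) + restr {..<m} z j)"
      by (auto simp: z_def u_def G_def restr_apply fun_eq_iff)
    then have "nrm z = nrm (\<lambda>j. (u j - restr G y j) + restr {..<m} z j)" by simp
    also have "\<dots> \<le> nrm (\<lambda>j. u j - restr G y j) + nrm (restr {..<m} z)"
      by (intro nrm_triangle diff_dwp restr_dwp u y z)
    also have "nrm (\<lambda>j. u j - restr G y j) \<le> nrm u + nrm (restr G y)"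
      by (intro nrm_triangle_diff_le restr_dwp u y)
    finally have zle: "nrm z \<le> nrm u + nrm (restr G y) + nrm (restr {..<m} z)" by simp
    have "nrm (restr G y) \<le> nrm (restr {m..} y)"
      by (rule dwp_mono(2)[OF restr_dwp[OF y]]) (auto simp: restr_apply G_def)
    moreover have "nrm (restr {..<m} z) \<le> nrm (restr {..<m} x)"
      by (rule dwp_mono(2)[OF restr_dwp[OF x]]) (auto simp: restr_apply z_def)
    moreover have "\<delta> \<le> nrm z" using n(2) by (simp add: z_def x_def)
    ultimately have "\<delta> / 2 \<le> nrm u" using zle xm m(2) by simp
    then have "(\<delta> / 2) powr p \<le> nrm u powr p" using \<delta> p_pos by (intro powr_mono2) auto
    then have "2 * \<theta> < (\<Sum>i. w i * xstar u i powr p)" using \<theta>(2) nrm_powr[OF u] by simp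
    moreover have "(\<lambda>N. \<Sum>i<N. w i * xstar u i powr p) \<longlonglongrightarrow> (\<Sum>i. w i * xstar u i powr p)"
      using u by (intro summable_LIMSEQ) (simp add: lorentz_space_def)
    ultimately have "\<forall>\<^sub>F N in sequentially. 2 * \<theta> < (\<Sum>i<N. w i * xstar u i powr p)"
      using order_tendstoD(1) by blast
    then obtain N where N: "2 * \<theta> < (\<Sum>i<N. w i * xstar u i powr p)"
      by (auto simp: eventually_sequentially)
    obtain \<tau> where \<tau>: "inj_on \<tau> {..<N}" "\<And>i. i < N \<Longrightarrow> \<bar>u (\<tau> i)\<bar> = xstar u i"
      using xstar_attained[OF dwp_tendsto[OF u]] by blast
    let ?f = "\<lambda>i. w i * \<bar>u (\<tau> i)\<bar> powr p"
    \<comment> \<open>Starting at \<open>M\<close> keeps the new slots apart from \<open>I\<close>;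
      demanding nonzero entries of \<open>u\<close> forces \<open>\<tau>\<close> to map
      \<open>J\<close> into \<open>G\<close>, hence beyond all old positions.\<close>
    define J where "J = {i. M \<le> i \<and> i < N \<and> u (\<tau> i) \<noteq> 0}"
    have J: "finite J" "J \<subseteq> {..<N}" by (auto simp: J_def)
    have fN: "2 * \<theta> < (\<Sum>i<N. ?f i)" using N \<tau>(2) by simp
    have usmall: "\<bar>u j\<bar> \<le> 2 * \<epsilon>" for j
      using ysmall[of j] \<epsilon>(1) by (auto simp: u_def restr_apply G_def)
    have w1: "w i \<le> 1" for i using decseqD[OF dec, of 0 i] w0 by simp
    have "(\<Sum>i\<in>{..<N} - J. ?f i) = (\<Sum>i\<in>{..<N} \<inter> {..<M}. ?f i)"
      by (rule sum.mono_neutral_right) (auto simp: J_def)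
    also have "\<dots> \<le> (\<Sum>i\<in>{..<N} \<inter> {..<M}. 1 * (2 * \<epsilon>) powr p)"
      using w1 w_nonneg usmall p_pos by (intro sum_mono mult_mono powr_mono2) auto
    also have "\<dots> = real (card ({..<N} \<inter> {..<M})) * (2 * \<epsilon>) powr p" by simp
    also have "\<dots> \<le> real (card {..<M}) * (2 * \<epsilon>) powr p"
      by (intro mult_right_mono of_nat_mono card_mono) auto
    also have "\<dots> \<le> \<theta>" unfolding \<epsilon>(2) using \<theta>(1) by (simp add: field_simps)
    finally have fJ: "\<theta> < (\<Sum>i\<in>J. ?f i)"
      using fN sum.subset_diff[OF J(2), of ?f] by simp
    define \<rho> where "\<rho> i = (if i \<in> I then \<sigma> i else \<tau> i)" for i
    have disj: "I \<inter> J = {}" using M by (auto simp: J_def)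
    have \<tau>G: "\<tau> i \<in> G" if "i \<in> J" for i using that by (auto simp: J_def u_def restr_apply split: if_splits)
    have inj: "inj_on \<rho> (I \<union> J)"
    proof (rule inj_on_disjoint_Un[where f=\<sigma> and g=\<tau> and A=I and B=J, folded \<rho>_def])
      show "\<sigma> ` I \<inter> \<tau> ` J = {}" using m1 m(1) \<tau>G by (fastforce simp: G_def)
    qed (use I(2) \<tau>(1) J(2) inj_on_subset disj in auto)
    have sJ: "\<bar>\<Sum>k\<in>insert n A. S (unit_vec k) (\<rho> i)\<bar> = \<bar>u (\<tau> i)\<bar>" if "i \<in> J" for i
      using that disj nA A(1) \<tau>G[OF that] by (auto simp: \<rho>_def u_def restr_apply y_def x_def add.commute)
    have sI: "(\<Sum>k\<in>insert n A. S (unit_vec k) (\<rho> i)) = y (\<sigma> i) + x (\<sigma> i)" if "i \<in> I" for i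
      using that nA A(1) by (auto simp: \<rho>_def y_def x_def add.commute)
    have "(\<Sum>i\<in>I \<union> J. w i * \<bar>\<Sum>k\<in>insert n A. S (unit_vec k) (\<rho> i)\<bar> powr p)
      = (\<Sum>i\<in>I. w i * \<bar>y (\<sigma> i) + x (\<sigma> i)\<bar> powr p) + (\<Sum>i\<in>J. ?f i)"
      unfolding sum.union_disjoint[OF I(1) J(1) disj] using sI sJ by simp
    then have "real (Suc K) * \<theta> - 1 < (\<Sum>i\<in>I \<union> J. w i * \<bar>\<Sum>k\<in>insert n A. S (unit_vec k) (\<rho> i)\<bar> powr p)"
      using xI fJ by (simp add: algebra_simps)
    moreover have "finite (insert n A)" "card (insert n A) = Suc K" "finite (I \<union> J)"
      using A I(1) J(1) nA by auto
    ultimately show ?case using inj by blast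
  qed
  obtain C where C: "0 < C" "\<And>x. x \<in> dwp \<Longrightarrow> nrm (S x) \<le> C * nrm x"
    using op_bounded[OF S] by blast
  have up: "real K * \<theta> - 1 < C powr p * (\<Sum>i<K. w i)" for K
  proof -
    obtain A I \<sigma> where A: "finite A" "card A = K" and I: "finite I" "inj_on \<sigma> I"
      and low: "real K * \<theta> - 1 < (\<Sum>i\<in>I. w i * \<bar>\<Sum>n\<in>A. S (unit_vec n) (\<sigma> i)\<bar> powr p)"
      using claim[of K] by blast
    define v where "v = restr A (\<lambda>_. 1)"
    have v: "v \<in> dwp" by (rule finite_support_dwp(1)[OF A(1)]) (simp add: v_def restr_apply)
    have nv: "nrm v powr p \<le> (\<Sum>i<K. w i)" unfolding A(2)[symmetric]
      by (rule finite_support_dwp(2)[OF A(1)]) (auto simp: v_def restr_apply)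
    have Sv: "S v j = (\<Sum>n\<in>A. S (unit_vec n) j)" for j
      unfolding v_def op_restr_finite[OF S A(1)] by simp
    have "real K * \<theta> - 1 < nrm (S v) powr p"
      using low sum_le_nrm[OF op_dwp[OF S v] I] by (simp add: Sv)
    also have "\<dots> \<le> (C * nrm v) powr p" using C(2)[OF v] p_pos nrm_nonneg by (intro powr_mono2) auto
    also have "\<dots> = C powr p * nrm v powr p" using C(1) nrm_nonneg by (simp add: powr_mult)
    also have "\<dots> \<le> C powr p * (\<Sum>i<K. w i)" using nv by (intro mult_left_mono) auto
    finally show ?thesis .
  qed
  have Cp: "0 < C powr p" using C by simp
  have "\<forall>\<^sub>F K in sequentially. (\<Sum>i<K. w i) \<le> \<theta> / (2 * C powr p) * real K"
    using \<theta>(1) Cp by (intro weight_sum_sublinear) simp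
  then obtain K0 where K0: "\<And>K. K0 \<le> K \<Longrightarrow> (\<Sum>i<K. w i) \<le> \<theta> / (2 * C powr p) * real K"
    by (auto simp: eventually_sequentially)
  \<comment> \<open>\<open>K1\<close> is large enough for linear growth to outweigh the slack
    \<open>- 1\<close>.\<close>
  obtain K1 :: nat where K1: "2 / \<theta> \<le> real K1" using real_arch_simple by blast
  define K where "K = max K0 K1"
  have "C powr p * (\<Sum>i<K. w i) \<le> C powr p * (\<theta> / (2 * C powr p) * real K)"
    by (rule mult_left_mono[OF K0]) (auto simp: K_def)
  also have "\<dots> = \<theta> * real K / 2" using C by simp
  finally have "real K * \<theta> - 1 < \<theta> * real K / 2" using up[of K] by linarith
  then have "\<theta> * real K < 2" by (simp add: field_simps)
  moreover have "2 \<le> \<theta> * real K1" using K1 \<theta>(1) by (simp add: field_simps)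
  moreover have "\<theta> * real K1 \<le> \<theta> * real K" using \<theta>(1) by (simp add: K_def)
  ultimately show False by linarith
qed

section \<open>Strict singularity\<close>

text \<open>On \<open>range \<iota>\<close> the image is a diagonal part plus an error. The diagonal
  part is a spread-out multiple of the argument with factors at least \<open>\<epsilon>\<close>; the
  error sums to at most \<open>\<epsilon> / 2\<close> times the norm by a geometric series.
  Restricting to \<open>range \<iota>\<close> only decreases the norm.\<close>

lemma op_diagonal_finite:
  assumes R: "lorentz_operator w p R" and inj: "inj \<iota>" and \<epsilon>: "0 < \<epsilon>"
    and big: "\<And>k. \<epsilon> \<le> \<bar>R (unit_vec k) (\<iota> k)\<bar>"
    and off: "\<And>k. nrm (restr (range \<iota> - {\<iota> k}) (R (unit_vec k))) \<le> \<epsilon> / 4 * (1 / 2) ^ k"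
  shows "\<epsilon> / 2 * nrm (restr {..<N} a) \<le> nrm (R (restr {..<N} a))"
proof -
  define y where "y = restr {..<N} a"
  define x where "x k = R (unit_vec k)" for k
  have x: "x k \<in> dwp" for k unfolding x_def by (rule op_dwp[OF R unit_vec_dwp])
  have y: "y \<in> dwp" unfolding y_def by (rule finite_support_dwp(1)[of "{..<N}"]) (auto simp: restr_apply)
  have d: "(\<lambda>k. y k * x k (\<iota> k)) \<in> dwp"
    by (rule finite_support_dwp(1)[of "{..<N}"]) (auto simp: restr_apply y_def)
  have Ry: "R y j = (\<Sum>k<N. y k * x k j)" for j
    unfolding y_def x_def op_restr_finite[OF R finite_lessThan] by (simp add: restr_apply)
  have Rydwp: "R y \<in> dwp" by (rule op_dwp[OF R y])
  define diag where "diag = spread \<iota> (\<lambda>k. y k * x k (\<iota> k))"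
  define err where "err = (\<lambda>j. \<Sum>k<N. y k * restr (range \<iota> - {\<iota> k}) (x k) j)"
  have diag: "diag \<in> dwp" "nrm diag = nrm (\<lambda>k. y k * x k (\<iota> k))"
    unfolding diag_def by (rule spread_dwp[OF d inj])+
  have err: "err \<in> dwp" unfolding err_def by (intro sum_dwp scale_dwp(1) restr_dwp x)
  have "restr (range \<iota>) (R y) j = diag j + err j" for j
  proof (cases "j \<in> range \<iota>")
    case True
    then obtain l where l: "j = \<iota> l" by blast
    have e: "err j = (\<Sum>k<N. if k = l then 0 else y k * x k j)"
      unfolding err_def l using inj by (intro sum.cong) (auto simp: restr_apply dest: injD)
    have "R y j = (\<Sum>k<N. (if k = l then y k * x k j else 0) + (if k = l then 0 else y k * x k j))"
      unfolding Ry by (intro sum.cong) auto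
    also have "\<dots> = (if l < N then y l * x l j else 0) + err j"
      unfolding sum.distrib e by (simp add: sum.delta)
    also have "(if l < N then y l * x l j else 0) = diag j"
      unfolding diag_def l spread_apply[OF inj] by (simp add: y_def restr_apply)
    finally show ?thesis using True by (simp add: restr_apply)
  next
    case False
    then show ?thesis by (simp add: restr_apply diag_def spread_def err_def)
  qed
  then have split: "restr (range \<iota>) (R y) = (\<lambda>j. diag j + err j)" by blast
  have "nrm diag \<le> nrm (restr (range \<iota>) (R y)) + nrm (\<lambda>j. diag j - restr (range \<iota>) (R y) j)"
    by (intro nrm_triangle_le diag restr_dwp Rydwp)
  also have "(\<lambda>j. diag j - restr (range \<iota>) (R y) j) = (\<lambda>j. (-1) * err j)" by (simp add: split)
  also have "nrm \<dots> = nrm err" using nrm_scale[OF err, of "-1"] by simp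
  also have "nrm (restr (range \<iota>) (R y)) \<le> nrm (R y)" by (rule nrm_restr_le[OF Rydwp])
  finally have 1: "nrm diag \<le> nrm (R y) + nrm err" by simp
  have "nrm (\<lambda>k. \<epsilon> * y k) \<le> nrm (\<lambda>k. y k * x k (\<iota> k))"
  proof (rule dwp_mono(2)[OF d])
    fix k show "\<bar>\<epsilon> * y k\<bar> \<le> \<bar>y k * x k (\<iota> k)\<bar>"
      using mult_right_mono[OF big[of k], of "\<bar>y k\<bar>"] \<epsilon> by (simp add: abs_mult mult.commute x_def)
  qed
  then have 2: "\<epsilon> * nrm y \<le> nrm diag" using nrm_scale[OF y, of \<epsilon>] \<epsilon> diag(2) by simp
  have "nrm err \<le> (\<Sum>k<N. nrm (\<lambda>j. y k * restr (range \<iota> - {\<iota> k}) (x k) j))"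
    unfolding err_def by (intro nrm_sum_le scale_dwp(1) restr_dwp x)
  also have "\<dots> = (\<Sum>k<N. \<bar>y k\<bar> * nrm (restr (range \<iota> - {\<iota> k}) (x k)))"
    by (intro sum.cong refl nrm_scale restr_dwp x)
  also have "\<dots> \<le> (\<Sum>k<N. nrm y * (\<epsilon> / 4 * (1 / 2) ^ k))"
    using off by (intro sum_mono mult_mono abs_le_nrm[OF y] nrm_nonneg) (auto simp: x_def)
  also have "\<dots> = nrm y * (\<epsilon> / 4) * (\<Sum>k<N. (1 / 2) ^ k)" by (simp add: sum_distrib_left mult_ac)
  also have "\<dots> \<le> nrm y * (\<epsilon> / 4) * 2"
  proof (rule mult_left_mono)
    show "(\<Sum>k<N. (1 / 2 :: real) ^ k) \<le> 2" by (simp add: sum_gp_strict)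
  qed (use \<epsilon> nrm_nonneg in simp)
  finally have "nrm err \<le> \<epsilon> / 2 * nrm y" by simp
  then show ?thesis using 1 2 unfolding y_def[symmetric] by simp
qed

text \<open>Density of finitely supported vectors: cutting off a tail changes the two sides by at
  most \<open>c\<close> and \<open>C\<close> times the norm of the tail.\<close>

lemma bounded_below_of_finite:
  assumes R: "lorentz_operator w p R" and c: "0 \<le> c"
    and fin: "\<And>a N. c * nrm (restr {..<N} a) \<le> nrm (R (restr {..<N} a))"
    and x: "x \<in> dwp"
  shows "c * nrm x \<le> nrm (R x)"
proof (rule field_le_epsilon)
  fix e :: real assume e: "0 < e"
  obtain C where C: "0 < C" "\<And>x. x \<in> dwp \<Longrightarrow> nrm (R x) \<le> C * nrm x"
    using op_bounded[OF R] by blast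
  have "0 < e / (c + C)" using e C c by simp
  then obtain m where m: "nrm (restr {m..} x) \<le> e / (c + C)" using tail_small[OF x] by blast
  let ?h = "restr {..<m} x" and ?t = "restr {m..} x"
  have ht: "?h \<in> dwp" "?t \<in> dwp" by (rule restr_dwp[OF x])+
  have xs: "x = (\<lambda>k. ?h k + ?t k)" by (auto simp: restr_apply)
  have "nrm x \<le> nrm ?h + nrm ?t" using nrm_triangle[OF ht] xs by simp
  then have "c * nrm x \<le> c * nrm ?h + c * nrm ?t" using mult_left_mono[OF _ c] by (simp add: distrib_left[symmetric])
  also have "c * nrm ?h \<le> nrm (R ?h)" by (rule fin)
  also have "nrm (R ?h) \<le> nrm (R x) + nrm (\<lambda>k. R ?h k - R x k)"
    by (intro nrm_triangle_le op_dwp[OF R] ht x)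
  also have "(\<lambda>k. R ?h k - R x k) = (\<lambda>k. (-1) * R ?t k)"
    using op_add[OF R ht] xs by (simp add: fun_eq_iff)
  also have "nrm \<dots> = nrm (R ?t)" using nrm_scale[OF op_dwp[OF R ht(2)], of "-1"] by simp
  also have "nrm (R ?t) \<le> C * nrm ?t" by (rule C(2)[OF ht(2)])
  finally have "c * nrm x \<le> nrm (R x) + (c + C) * nrm ?t" by (simp add: algebra_simps)
  also have "(c + C) * nrm ?t \<le> e" using m C c by (simp add: field_simps)
  finally show "c * nrm x \<le> nrm (R x) + e" by simp
qed

text \<open>A gliding hump: \<open>\<nu>\<close> and \<open>\<iota>\<close> are chosen so that \<open>T (unit_vec (\<nu> k))\<close> is large at \<open>\<iota> k\<close> and
  nearly vanishes at all other \<open>\<iota> l\<close>, so \<open>T\<close> is close to a diagonal operator there.\<close>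
lemma op_fixes_copy:
  assumes T: "lorentz_operator w p T" and \<epsilon>: "0 < \<epsilon>"
    and freq: "\<And>n0. \<exists>n\<ge>n0. \<exists>j. \<epsilon> \<le> \<bar>T (unit_vec n) j\<bar>"
  shows "\<exists>\<nu>. inj \<nu> \<and> (\<forall>x\<in>dwp. \<epsilon> / 2 * nrm x \<le> nrm (T (spread \<nu> x)))"
proof -
  have Te: "T (unit_vec n) \<in> dwp" for n by (rule op_dwp[OF T unit_vec_dwp])
  \<comment> \<open>Half of the off-diagonal bound in \<open>op_diagonal_finite\<close>, once for
    the head and once for the tail of each image.\<close>
  let ?r = "\<lambda>k::nat. \<epsilon> / 8 * (1 / 2) ^ k"
  have r: "0 < ?r k" "?r k < \<epsilon>" for k
  proof -
    show "0 < ?r k" using \<epsilon> by simp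
    have "?r k \<le> \<epsilon> / 8 * 1" using \<epsilon> by (intro mult_left_mono power_le_one) auto
    then show "?r k < \<epsilon>" using \<epsilon> by simp
  qed
  \<comment> \<open>A state consists of the index \<open>n\<close> of a unit vector, a position
    \<open>j\<close> where its image is large, and a cutoff \<open>m\<close> beyond which the image
    is negligible.\<close>
  define P where "P k s = (case s of (n, j, m) \<Rightarrow> \<epsilon> \<le> \<bar>T (unit_vec n) j\<bar> \<and> j < m \<and>
      nrm (restr {m..} (T (unit_vec n))) \<le> ?r k)" for k and s :: "nat \<times> nat \<times> nat"
  define Q where "Q k s s' = (case s of (n, j, m) \<Rightarrow> case s' of (n', j', m') \<Rightarrow> n < n' \<and> m \<le> j' \<and>
      nrm (restr {..<m} (T (unit_vec n'))) \<le> ?r (Suc k))" for k and s s' :: "nat \<times> nat \<times> nat"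
  have ext: "\<exists>m. P k (n, j, m)" if "\<epsilon> \<le> \<bar>T (unit_vec n) j\<bar>" for k n j
  proof -
    obtain m0 where "\<And>m. m0 \<le> m \<Longrightarrow> nrm (restr {m..} (T (unit_vec n))) \<le> ?r k"
      using tail_small[OF Te r(1)] by blast
    then show ?thesis using that by (intro exI[of _ "max m0 (Suc j)"]) (simp add: P_def)
  qed
  have "\<exists>f. \<forall>k. P k (f k) \<and> Q k (f k) (f (Suc k))"
  proof (rule dependent_nat_choice)
    show "\<exists>s. P 0 s" using freq[of 0] ext by blast
    fix s :: "nat \<times> nat \<times> nat" and k
    obtain n j m where s: "s = (n, j, m)" by (cases s)
    obtain n0 where n0: "\<And>n'. n0 \<le> n' \<Longrightarrow> nrm (restr {..<m} (T (unit_vec n'))) < ?r (Suc k)"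
      using order_tendstoD(2)[OF op_head_null[OF T] r(1), of m "Suc k"]
      unfolding eventually_sequentially by blast
    obtain n' j' where n': "max n0 (Suc n) \<le> n'" "\<epsilon> \<le> \<bar>T (unit_vec n') j'\<bar>" using freq by blast
    have hd: "nrm (restr {..<m} (T (unit_vec n'))) < ?r (Suc k)" using n0 n'(1) by simp
    \<comment> \<open>A large coordinate below \<open>m\<close> would exceed the norm of the head,
      which is less than \<open>\<epsilon>\<close>.\<close>
    have "m \<le> j'"
    proof (rule ccontr)
      assume "\<not> m \<le> j'"
      then have "\<bar>T (unit_vec n') j'\<bar> \<le> nrm (restr {..<m} (T (unit_vec n')))"
        using abs_le_nrm[OF restr_dwp[OF Te], of "{..<m}" n' j'] by (simp add: restr_apply)
      then show False using n'(2) hd r(2)[of "Suc k"] by linarith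
    qed
    moreover obtain m' where "P (Suc k) (n', j', m')" using ext[OF n'(2)] by blast
    ultimately show "\<exists>s'. P (Suc k) s' \<and> Q k s s'"
      using n'(1) hd by (intro exI[of _ "(n', j', m')"]) (simp add: Q_def s)
  qed
  then obtain f where f: "\<And>k. P k (f k)" "\<And>k. Q k (f k) (f (Suc k))" by blast
  define \<nu> where "\<nu> k = fst (f k)" for k
  define \<iota> where "\<iota> k = fst (snd (f k))" for k
  define \<mu> where "\<mu> k = snd (snd (f k))" for k
  have fk: "f k = (\<nu> k, \<iota> k, \<mu> k)" for k by (simp add: \<nu>_def \<iota>_def \<mu>_def)
  have Pk: "\<epsilon> \<le> \<bar>T (unit_vec (\<nu> k)) (\<iota> k)\<bar>" "\<iota> k < \<mu> k" "nrm (restr {\<mu> k..} (T (unit_vec (\<nu> k)))) \<le> ?r k" for k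
    using f(1)[of k] unfolding fk P_def by auto
  have Qk: "\<nu> k < \<nu> (Suc k)" "\<mu> k \<le> \<iota> (Suc k)" "nrm (restr {..<\<mu> k} (T (unit_vec (\<nu> (Suc k))))) \<le> ?r (Suc k)" for k
    using f(2)[of k] unfolding fk Q_def by auto
  have inj\<nu>: "inj \<nu>" using Qk(1) by (intro strict_mono_imp_inj_on) (simp add: strict_mono_Suc_iff)
  have sm: "strict_mono \<iota>" unfolding strict_mono_Suc_iff using Pk(2) Qk(2) by (meson less_le_trans)
  have inj: "inj \<iota>" by (rule strict_mono_imp_inj_on[OF sm])
  have R: "lorentz_operator w p (\<lambda>x. T (spread \<nu> x))" by (rule op_comp[OF op_spread[OF inj\<nu>] T])
  have Re: "T (spread \<nu> (unit_vec k)) = T (unit_vec (\<nu> k))" for k by (simp add: spread_unit_vec[OF inj\<nu>])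
  have off: "nrm (restr (range \<iota> - {\<iota> k}) (T (unit_vec (\<nu> k)))) \<le> \<epsilon> / 4 * (1 / 2) ^ k" for k
  proof -
    let ?x = "T (unit_vec (\<nu> k))"
    \<comment> \<open>The previous cutoff; the first image has no predecessor, so its head is
      empty.\<close>
    define h where "h = (case k of 0 \<Rightarrow> 0 | Suc l \<Rightarrow> \<mu> l)"
    have h: "nrm (restr {..<h} ?x) \<le> ?r k"
    proof (cases k)
      case 0
      then have "restr {..<h} ?x = (\<lambda>_. 0)" by (simp add: h_def restr_def)
      then show ?thesis using r(1)[of k] by (simp add: nrm_zero)
    next
      case (Suc l)
      then show ?thesis using Qk(3)[of l] by (simp add: h_def)
    qed
    have cover: "\<iota> l < h \<or> \<mu> k \<le> \<iota> l" if "l \<noteq> k" for l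
    proof (cases "l < k")
      case True
      then obtain k' where k': "k = Suc k'" "l \<le> k'" by (cases k) auto
      then have "\<iota> l \<le> \<iota> k'" using sm by (simp add: strict_mono_less_eq)
      then show ?thesis using Pk(2)[of k'] k'(1) by (simp add: h_def)
    next
      case False
      then have "\<iota> (Suc k) \<le> \<iota> l" using sm that by (simp add: strict_mono_less_eq)
      then show ?thesis using Qk(2)[of k] by simp
    qed
    have lr: "\<bar>restr (range \<iota> - {\<iota> k}) ?x i\<bar> \<le> \<bar>restr ({..<h} \<union> {\<mu> k..}) ?x i\<bar>" for i
    proof (cases "i \<in> range \<iota> - {\<iota> k}")
      case True
      then obtain l where "i = \<iota> l" "l \<noteq> k" by blast
      then show ?thesis using cover[of l] by (simp add: restr_apply)
    next
      case False
      then have "restr (range \<iota> - {\<iota> k}) ?x i = 0" by (simp only: restr_apply if_False)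
      then show ?thesis by simp
    qed
    have "nrm (restr (range \<iota> - {\<iota> k}) ?x) \<le> nrm (restr ({..<h} \<union> {\<mu> k..}) ?x)"
      by (rule dwp_mono(2)[OF restr_dwp[OF Te] lr])
    also have "restr ({..<h} \<union> {\<mu> k..}) ?x = (\<lambda>i. restr {..<h} ?x i + restr ({\<mu> k..} - {..<h}) ?x i)"
      by (auto simp: restr_apply)
    also have "nrm \<dots> \<le> nrm (restr {..<h} ?x) + nrm (restr ({\<mu> k..} - {..<h}) ?x)"
      by (intro nrm_triangle restr_dwp Te)
    also have "nrm (restr ({\<mu> k..} - {..<h}) ?x) \<le> nrm (restr {\<mu> k..} ?x)"
      by (rule dwp_mono(2)[OF restr_dwp[OF Te]]) (auto simp: restr_apply)
    finally show ?thesis using h Pk(3)[of k] by simp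
  qed
  have "\<epsilon> / 2 * nrm x \<le> nrm (T (spread \<nu> x))" if "x \<in> dwp" for x
    using bounded_below_of_finite[OF R _ op_diagonal_finite[OF R inj \<epsilon>, unfolded Re, OF Pk(1) off] that] \<epsilon>
    by simp
  then show ?thesis using inj\<nu> by blast
qed

text \<open>By \<open>op_small_coordinates\<close>, images of norm at least \<open>\<delta>\<close>
  cannot consist of small coordinates only, so infinitely many have a coordinate of modulus at least
  \<open>\<epsilon>\<close> and \<open>op_fixes_copy\<close> applies.\<close>

lemma strictly_singular_imp_null:
  assumes T: "lorentz_operator w p T" and ss: "lorentz_strictly_singular w p T"
  shows "(\<lambda>n. nrm (T (unit_vec n))) \<longlonglongrightarrow> 0"
proof (rule ccontr)
  assume "\<not> ?thesis"
  then obtain \<delta> where \<delta>: "0 < \<delta>" "\<And>n0. \<exists>n\<ge>n0. \<delta> \<le> nrm (T (unit_vec n))"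
    unfolding LIMSEQ_iff by (auto simp: not_less nrm_nonneg)
  obtain \<epsilon> n1 where \<epsilon>: "0 < \<epsilon>"
    and n1: "\<And>n. n1 \<le> n \<Longrightarrow> nrm (restr {k. \<bar>T (unit_vec n) k\<bar> \<le> \<epsilon>} (T (unit_vec n))) < \<delta>"
    using op_small_coordinates[OF T \<delta>(1)] by (auto simp: eventually_sequentially)
  have "\<exists>n\<ge>n0. \<exists>j. \<epsilon> \<le> \<bar>T (unit_vec n) j\<bar>" for n0
  proof -
    obtain n where n: "max n0 n1 \<le> n" "\<delta> \<le> nrm (T (unit_vec n))" using \<delta>(2) by blast
    have "\<exists>j. \<epsilon> \<le> \<bar>T (unit_vec n) j\<bar>"
    proof (rule ccontr)
      assume "\<nexists>j. \<epsilon> \<le> \<bar>T (unit_vec n) j\<bar>"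
      then have "\<bar>T (unit_vec n) j\<bar> \<le> \<epsilon>" for j by (meson less_imp_le not_less)
      then have "restr {k. \<bar>T (unit_vec n) k\<bar> \<le> \<epsilon>} (T (unit_vec n)) = T (unit_vec n)"
        by (simp add: restr_def)
      then show False using n1[of n] n by simp
    qed
    then show ?thesis using n(1) by auto
  qed
  from op_fixes_copy[OF T \<epsilon> this] obtain \<nu> where \<nu>: "inj \<nu>"
    "\<And>x. x \<in> dwp \<Longrightarrow> \<epsilon> / 2 * nrm x \<le> nrm (T (spread \<nu> x))" by blast
  \<comment> \<open>The range of \<open>spread \<nu>\<close>, described by vanishing coordinates so
    that closedness follows from \<open>abs_le_nrm\<close>.\<close>
  define Z where "Z = {x \<in> dwp. \<forall>k. k \<notin> range \<nu> \<longrightarrow> x k = 0}"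
  have Zeq: "spread \<nu> ` dwp = Z"
  proof (intro equalityI subsetI)
    fix z assume z: "z \<in> Z"
    have "z = spread \<nu> (\<lambda>k. z (\<nu> k))"
    proof
      fix i show "z i = spread \<nu> (\<lambda>k. z (\<nu> k)) i"
        using z by (cases "i \<in> range \<nu>") (auto simp: Z_def spread_def f_inv_into_f)
    qed
    moreover have "(\<lambda>k. z (\<nu> k)) \<in> dwp" using reindex_dwp(1)[OF _ \<nu>(1)] z by (simp add: Z_def)
    ultimately show "z \<in> spread \<nu> ` dwp" by blast
  qed (use spread_dwp(1)[OF _ \<nu>(1)] in \<open>auto simp: Z_def\<close>, simp add: spread_def)
  have "closed_lorentz_subspace w p Z"
    unfolding closed_lorentz_subspace_def lin_subspace_def
  proof (intro conjI allI impI ballI)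
    fix f x assume a: "(\<forall>j. f j \<in> Z) \<and> x \<in> dwp \<and> (\<lambda>j. nrm (\<lambda>k. f j k - x k)) \<longlonglongrightarrow> 0"
    have "x k = 0" if "k \<notin> range \<nu>" for k
    proof -
      have "\<bar>x k\<bar> \<le> nrm (\<lambda>k. f j k - x k)" for j
        using abs_le_nrm[OF diff_dwp, of "f j" x k] a that by (simp add: Z_def)
      then have "\<bar>x k\<bar> \<le> 0" using a by (intro LIMSEQ_le_const[of _ 0]) auto
      then show ?thesis by simp
    qed
    then show "x \<in> Z" using a by (simp add: Z_def)
  qed (auto simp: Z_def zero_dwp add_dwp scale_dwp(1))
  moreover have "iso_to_lorentz w p Z"
    unfolding iso_to_lorentz_def
  proof (intro exI conjI ballI)
    show "linear_on dwp (spread \<nu>)" using op_spread[OF \<nu>(1)] by (simp add: lorentz_operator_def)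
    show "1 * nrm x \<le> nrm (spread \<nu> x)" "nrm (spread \<nu> x) \<le> 1 * nrm x" if "x \<in> dwp" for x
      using spread_dwp(2)[OF that \<nu>(1)] by simp_all
  qed (simp_all add: Zeq)
  moreover have "iso_on w p T Z"
    unfolding iso_on_def Zeq[symmetric]
    using \<epsilon> \<nu>(2) spread_dwp(2)[OF _ \<nu>(1)] by (intro exI[of _ "\<epsilon> / 2"]) auto
  ultimately show False using ss by (auto simp: lorentz_strictly_singular_def)
qed

text \<open>\<open>K\<close> coordinates above \<open>\<epsilon>\<close> cost at least
  \<open>\<epsilon> powr p\<close> times the sum of the first \<open>K\<close> weights, which is
  unbounded since \<open>w\<close> is not summable; hence one \<open>K\<close> serves the whole
  ball.\<close>

lemma card_large_coordinates_bounded: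
  assumes "0 < \<epsilon>"
  shows "\<exists>K. \<forall>x\<in>dwp. nrm x \<le> B \<longrightarrow> finite {k. \<epsilon> < \<bar>x k\<bar>} \<and> card {k. \<epsilon> < \<bar>x k\<bar>} < K"
proof -
  have ep: "0 < \<epsilon> powr p" using assms by simp
  obtain K where K: "B powr p / \<epsilon> powr p < (\<Sum>i<K. w i)" using weight_sum_unbounded by blast
  have "finite {k. \<epsilon> < \<bar>x k\<bar>} \<and> card {k. \<epsilon> < \<bar>x k\<bar>} < K" if x: "x \<in> dwp" "nrm x \<le> B" for x
  proof (rule ccontr)
    let ?L = "{k. \<epsilon> < \<bar>x k\<bar>}"
    assume "\<not> (finite ?L \<and> card ?L < K)"
    then have "\<exists>A. A \<subseteq> ?L \<and> card A = K \<and> finite A"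
      using infinite_arbitrarily_large[of ?L K] obtain_subset_with_card_n[of K ?L]
      by (metis finite_subset not_less)
    then obtain A where A: "A \<subseteq> ?L" "card A = K" "finite A" by blast
    obtain \<sigma> where \<sigma>: "bij_betw \<sigma> {..<K} A"
      using ex_bij_betw_nat_finite[OF A(3)] A(2) by (auto simp: atLeast0LessThan)
    have "(\<Sum>i<K. w i * \<epsilon> powr p) \<le> (\<Sum>i<K. w i * \<bar>x (\<sigma> i)\<bar> powr p)"
    proof (intro sum_mono mult_left_mono w_nonneg powr_mono2)
      fix i assume "i \<in> {..<K}"
      then show "\<epsilon> \<le> \<bar>x (\<sigma> i)\<bar>" using bij_betwE[OF \<sigma>] A(1) by fastforce
    qed (use assms p_pos in auto)
    also have "\<dots> \<le> nrm x powr p"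
      by (rule sum_le_nrm[OF x(1)]) (use \<sigma> in \<open>auto simp: bij_betw_def\<close>)
    also have "\<dots> \<le> B powr p" using x(2) nrm_nonneg p_pos by (intro powr_mono2) auto
    finally have "(\<Sum>i<K. w i) * \<epsilon> powr p \<le> B powr p" by (simp add: sum_distrib_right)
    then show False using K ep by (simp add: divide_less_eq)
  qed
  then show ?thesis by blast
qed

text \<open>If \<open>T\<close> were bounded below on the range of an embedding \<open>S\<close>,
  the images of unit vectors under \<open>T\<close> after \<open>S\<close> would have norm at least
  \<open>c1 * c2\<close>. For one large \<open>n\<close>, the large and the small coordinates of
  \<open>z n\<close> each contribute at most half of this, the small ones strictly less.\<close>

lemma null_imp_strictly_singular:
  assumes T: "lorentz_operator w p T" and null: "(\<lambda>n. nrm (T (unit_vec n))) \<longlonglongrightarrow> 0"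
  shows "lorentz_strictly_singular w p T"
  unfolding lorentz_strictly_singular_def
proof (intro allI impI notI)
  fix Z assume Z: "closed_lorentz_subspace w p Z \<and> iso_to_lorentz w p Z" and iso: "iso_on w p T Z"
  obtain S c1 C1 where S1: "linear_on dwp S" "S ` dwp = Z" and c1: "0 < c1"
    and S2: "\<And>x. x \<in> dwp \<Longrightarrow> c1 * nrm x \<le> nrm (S x)" "\<And>x. x \<in> dwp \<Longrightarrow> nrm (S x) \<le> C1 * nrm x"
    using Z by (auto simp: iso_to_lorentz_def)
  obtain c2 where c2: "0 < c2" "\<And>z. z \<in> Z \<Longrightarrow> c2 * nrm z \<le> nrm (T z)"
    using iso by (auto simp: iso_on_def)
  have "Z \<subseteq> dwp" using Z by (simp add: closed_lorentz_subspace_def)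
  then have S: "lorentz_operator w p S" using S1 S2(2) by (auto simp: lorentz_operator_def)
  obtain C where C: "0 < C" "\<And>x. x \<in> dwp \<Longrightarrow> nrm (T x) \<le> C * nrm x" using op_bounded[OF T] by blast
  define z where "z n = S (unit_vec n)" for n
  have z: "z n \<in> dwp" "nrm (z n) \<le> C1" for n
    using op_dwp[OF S unit_vec_dwp, of n] S2(2)[OF unit_vec_dwp, of n] by (simp_all add: z_def nrm_unit_vec)
  have C1: "0 \<le> C1" using z(2)[of 0] nrm_nonneg[of "z 0"] by linarith
  have low: "c1 * c2 \<le> nrm (T (z n))" for n
  proof -
    have "c1 \<le> nrm (z n)" using S2(1)[OF unit_vec_dwp, of n] by (simp add: z_def nrm_unit_vec)
    then have "c1 * c2 \<le> c2 * nrm (z n)" using c2(1) by (simp add: mult.commute)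
    also have "\<dots> \<le> nrm (T (z n))" by (rule c2(2)) (use S1(2) unit_vec_dwp z_def in auto)
    finally show ?thesis .
  qed
  have "0 < c1 * c2 / (2 * C)" using c1 c2 C by simp
  from op_small_coordinates[OF S this] obtain \<epsilon> n1 where \<epsilon>: "0 < \<epsilon>"
    and n1: "\<And>n. n1 \<le> n \<Longrightarrow> nrm (restr {k. \<bar>z n k\<bar> \<le> \<epsilon>} (z n)) < c1 * c2 / (2 * C)"
    by (auto simp: eventually_sequentially z_def)
  obtain K where K: "\<And>n. finite {k. \<epsilon> < \<bar>z n k\<bar>} \<and> card {k. \<epsilon> < \<bar>z n k\<bar>} < K"
    using card_large_coordinates_bounded[OF \<epsilon>, of C1] z by blast
  \<comment> \<open>Fewer than \<open>K\<close> large coordinates of modulus at most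
    \<open>C1\<close>, each multiplied by an image of norm below \<open>e\<close>, stay within
    \<open>c1 * c2 / 2\<close>; the summand 1 keeps the denominator positive.\<close>
  define e where "e = c1 * c2 / (2 * (real K * C1 + 1))"
  have KC: "0 \<le> real K * C1" using C1 by simp
  then have e: "0 < e" using c1 c2(1) by (simp add: e_def)
  obtain m where m: "\<And>j. m \<le> j \<Longrightarrow> nrm (T (unit_vec j)) < e"
    using order_tendstoD(2)[OF null e] by (auto simp: eventually_sequentially)
  obtain n2 where n2: "\<And>n. n2 \<le> n \<Longrightarrow> nrm (restr {..<m} (z n)) < \<epsilon>"
    using order_tendstoD(2)[OF op_head_null[OF S] \<epsilon>] by (auto simp: eventually_sequentially z_def)
  define n where "n = max n1 n2"
  define L where "L = {k. \<epsilon> < \<bar>z n k\<bar>}"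
  have L: "finite L" "card L < K" using K by (auto simp: L_def)
  \<comment> \<open>A coordinate above \<open>\<epsilon>\<close> cannot sit in the head of
    \<open>z n\<close>, whose norm is below \<open>\<epsilon>\<close>; so only unit vectors with
    small image under \<open>T\<close> occur.\<close>
  have Lm: "m \<le> j" if "j \<in> L" for j
  proof (rule ccontr)
    assume "\<not> m \<le> j"
    then have "\<bar>z n j\<bar> \<le> nrm (restr {..<m} (z n))"
      using abs_le_nrm[OF restr_dwp[OF z(1)], of "{..<m}" n j] by (simp add: restr_apply)
    then show False using that n2[of n] by (simp add: L_def n_def)
  qed
  have "nrm (T (restr L (z n))) \<le> (\<Sum>j\<in>L. \<bar>z n j\<bar> * nrm (T (unit_vec j)))"
    by (rule nrm_op_restr_finite_le[OF T L(1)])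
  also have "\<dots> \<le> (\<Sum>j\<in>L. C1 * e)"
    using m Lm C1 order_trans[OF abs_le_nrm[OF z(1)] z(2)]
    by (intro sum_mono mult_mono nrm_nonneg) (auto intro: less_imp_le)
  also have "\<dots> = real (card L) * (C1 * e)" by simp
  also have "\<dots> \<le> real K * (C1 * e)" using L(2) C1 e by (intro mult_right_mono) auto
  also have "\<dots> \<le> (real K * C1 + 1) * e" using e by (simp add: algebra_simps)
  also have "\<dots> = c1 * c2 / 2"
  proof -
    have "t * (c / (2 * t)) = c / 2" if "t \<noteq> 0" for t c :: real using that by simp
    moreover have "real K * C1 + 1 \<noteq> 0" using KC by linarith
    ultimately show ?thesis unfolding e_def by blast
  qed
  finally have large: "nrm (T (restr L (z n))) \<le> c1 * c2 / 2" .
  have "nrm (T (restr (- L) (z n))) \<le> C * nrm (restr (- L) (z n))" by (intro C(2) restr_dwp z)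
  also have "- L = {k. \<bar>z n k\<bar> \<le> \<epsilon>}" by (auto simp: L_def)
  also have "C * nrm (restr {k. \<bar>z n k\<bar> \<le> \<epsilon>} (z n)) < C * (c1 * c2 / (2 * C))"
    using n1[of n] C(1) by (intro mult_strict_left_mono) (auto simp: n_def)
  also have "\<dots> = c1 * c2 / 2" using C(1) by simp
  finally have small: "nrm (T (restr (- L) (z n))) < c1 * c2 / 2" unfolding L_def by (simp add: Compl_eq not_less)
  have "z n = (\<lambda>k. restr L (z n) k + restr (- L) (z n) k)" by (auto simp: restr_apply)
  then have "T (z n) = (\<lambda>k. T (restr L (z n)) k + T (restr (- L) (z n)) k)"
    using op_add[OF T restr_dwp[OF z(1)] restr_dwp[OF z(1)], of L n "- L" n] by simp
  then have "nrm (T (z n)) \<le> nrm (T (restr L (z n))) + nrm (T (restr (- L) (z n)))"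
    using nrm_triangle[OF op_dwp[OF T restr_dwp[OF z(1)]] op_dwp[OF T restr_dwp[OF z(1)]]] by simp
  then show False using low[of n] large small by linarith
qed

end

theorem theorem5p5:
  fixes w :: "nat \<Rightarrow> real" and p :: real
    and T :: "(nat \<Rightarrow> real) \<Rightarrow> (nat \<Rightarrow> real)"
  assumes "1 \<le> p"
    and "w 0 = 1" and "decseq w" and "w \<longlonglongrightarrow> 0" and "\<not> summable w"
    and "lorentz_operator w p T"
  shows "lorentz_strictly_singular w p T \<longleftrightarrow>
         (\<lambda>n. lorentz_norm w p (T (unit_vec n))) \<longlonglongrightarrow> 0"
proof -
  interpret lorentz w p by unfold_locales (fact assms)+
  show ?thesis
    using strictly_singular_imp_null[OF assms(6)] null_imp_strictly_singular[OF assms(6)] by blast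
qed

end
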